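(* Let $q\geq 5$ be an integer and let $\chi$ be a nonprincipal Dirichlet character modulo $q$. Then for every real number $x$, $$\left|\sum_{m\leq x}\chi(m)\right|\ \leq\ \frac{\varphi(q)}{\sqrt{q}}\bigl(\log q+\log\log q+\log\log\log q+4\bigr).$$
   Context: The sum runs over positive integers $m\leq x$. $\varphi$ is Euler's totient function and $\log$ is the natural logarithm. *)

theory Defs
  imports Complex_Main "HOL-Number_Theory.Totient"
begin

definition dirichlet_character :: "nat \<Rightarrow> (int \<Rightarrow> complex) \<Rightarrow> bool" where
  "dirichlet_character q \<chi> \<longleftrightarrow>
     (\<forall>a. \<chi> (a + int q) = \<chi> a) \<and>
     (\<forall>a b. \<chi> (a * b) = \<chi> a * \<chi> b) \<and>
     (\<forall>a. \<chi> a \<noteq> 0 \<longleftrightarrow> coprime a (int q))"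

definition principal_character :: "nat \<Rightarrow> int \<Rightarrow> complex" where
  "principal_character q a = (if coprime a (int q) then 1 else 0)"

end

(*
Let f mod d be the primitive character inducing chi, P the set of primes dividing q but not d, r the
product of P, and Q = d r, which divides q and has the same prime divisors; phi(n) / sqrt n increases
from Q to q. Removing from a character the multiples of a new prime p multiplies its Gauss sum at k
by p - 1 if p divides k and by -1 otherwise, up to a unimodular factor. Hence the Gauss sum of chi
mod Q at k has modulus sqrt d * w(k) if k is coprime to d and 0 otherwise, where w(k) is the product
of the p - 1 over the p in P dividing k. With 1 / sin y <= 1 / y + 1 / 2, completion leaves the sum of
w(k) |sin k theta| / k over k <= Q / 2 coprime to d, which is at most the product of the
2 (p - 1) / p over P times the sum of 1 / k over the same k; that last sum is evaluated with an
explicit error term by induction on the primes of d.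

Relative to phi(Q) / sqrt Q the loss in the leading constant is 2 / pi times the product of the
2 / sqrt p over P. This is below 1 except for P = {2, 3}, where it is about 1.04. Whenever 2 lies in
P, d is odd, and pairing the frequencies k and 2 k gains a factor sqrt 3 / 2, because
|sin t| + |sin 2t| / 2 <= 3 sqrt 3 / 4, which suffices. The outcome is
the bound phi(Q) / sqrt Q * (log Q + 29 / 5); for Q < 256 the trivial bound phi(Q) / 2 takes its place.
*)
theory Submission imports Defs "HOL-Analysis.Harmonic_Numbers" "HOL-Number_Theory.Residues"
begin

unbundle no vec_syntax

section \<open>Harmonic sums over integers free of given primes\<close>

text \<open>The cutoff is real so that it can be divided by primes. With the prime factors of
  \<open>d\<close> for \<open>R\<close>, these are the \<open>k\<close> up to \<open>Y\<close> that
  are coprime to \<open>d\<close>.\<close>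

definition cop_upto :: "nat set \<Rightarrow> real \<Rightarrow> nat set" where
  "cop_upto R Y = {k. 1 \<le> k \<and> real k \<le> Y \<and> (\<forall>p\<in>R. \<not> p dvd k)}"

lemma cop_upto_subset: "cop_upto R Y \<subseteq> {1..nat \<lfloor>Y\<rfloor>}"
  by (auto simp: cop_upto_def le_nat_floor)

lemma finite_cop_upto [simp, intro]: "finite (cop_upto R Y)"
  by (rule finite_subset[OF cop_upto_subset]) simp

lemma sum_cop_upto_multiples:
  assumes "p > 0" and "\<And>k r. r \<in> R \<Longrightarrow> r dvd p * k \<longleftrightarrow> r dvd k"
  shows "(\<Sum>k\<in>{k\<in>cop_upto R Y. p dvd k}. h k) = (\<Sum>k\<in>cop_upto R (Y / real p). h (p * k))"
proof -
  have *: "{k\<in>cop_upto R Y. p dvd k} = (*) p ` cop_upto R (Y / real p)"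
  proof (intro equalityI subsetI)
    fix k assume "k \<in> {k\<in>cop_upto R Y. p dvd k}"
    then obtain j where j: "k = p * j" and k: "1 \<le> k" "real k \<le> Y" "\<forall>r\<in>R. \<not> r dvd k"
      by (auto simp: cop_upto_def)
    have "j \<in> cop_upto R (Y / real p)"
      using k assms unfolding j by (auto simp: cop_upto_def field_simps Suc_le_eq)
    thus "k \<in> (*) p ` cop_upto R (Y / real p)" using j by blast
  qed (use assms in \<open>auto simp: cop_upto_def field_simps Suc_le_eq\<close>)
  have "inj_on ((*) p) (cop_upto R (Y / real p))"
    using assms by (auto intro: inj_onI)
  thus ?thesis unfolding * by (simp add: sum.reindex)
qed

lemma cop_upto_insert:
  "cop_upto (insert p R) Y = cop_upto R Y - {k\<in>cop_upto R Y. p dvd k}"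
  by (auto simp: cop_upto_def)

lemma prime_dvd_mult_prime_iff:
  "prime (p::nat) \<Longrightarrow> prime r \<Longrightarrow> r \<noteq> p \<Longrightarrow> r dvd p * k \<longleftrightarrow> r dvd k"
  by (metis prime_dvd_mult_iff primes_dvd_imp_eq)

lemma sum_cop_upto_split:
  fixes h :: "nat \<Rightarrow> real"
  assumes "prime p" "\<And>r. r \<in> R \<Longrightarrow> prime r" "p \<notin> R"
  shows "(\<Sum>k\<in>cop_upto R Y. h k) =
    (\<Sum>k\<in>cop_upto (insert p R) Y. h k) + (\<Sum>k\<in>cop_upto R (Y / real p). h (p * k))"
proof -
  have "(\<Sum>k\<in>cop_upto (insert p R) Y. h k) =
      (\<Sum>k\<in>cop_upto R Y. h k) - (\<Sum>k\<in>{k\<in>cop_upto R Y. p dvd k}. h k)"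
    unfolding cop_upto_insert by (rule sum_diff) auto
  also have "(\<Sum>k\<in>{k\<in>cop_upto R Y. p dvd k}. h k) = (\<Sum>k\<in>cop_upto R (Y / real p). h (p * k))"
    by (rule sum_cop_upto_multiples) (use assms prime_dvd_mult_prime_iff prime_gt_0_nat in blast)+
  finally show ?thesis by simp
qed

definition cop_harm :: "nat set \<Rightarrow> real \<Rightarrow> real" where
  "cop_harm R Y = (\<Sum>k\<in>cop_upto R Y. 1 / real k)"

lemma cop_harm_insert:
  assumes "prime p" "\<And>r. r \<in> R \<Longrightarrow> prime r" "p \<notin> R"
  shows "cop_harm (insert p R) Y = cop_harm R Y - cop_harm R (Y / real p) / real p"
proof -
  have "(\<Sum>k\<in>cop_upto R (Y / real p). 1 / real (p * k)) = cop_harm R (Y / real p) / real p"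
    by (simp add: cop_harm_def sum_divide_distrib field_simps)
  thus ?thesis using sum_cop_upto_split[OF assms, of "\<lambda>k. 1 / real k" Y] by (simp add: cop_harm_def)
qed

text \<open>Cutoffs below 1, where the sum is empty, are included because the induction on primes
  divides the cutoff repeatedly.\<close>

lemma cop_harm_empty:
  assumes "Y > 0"
  shows "\<bar>cop_harm {} Y - (ln Y + euler_mascheroni)\<bar> \<le> 1 / Y"
proof (cases "Y < 1")
  case True
  have "cop_upto {} Y = {}" using True by (auto simp: cop_upto_def)
  hence 0: "cop_harm {} Y = 0" by (simp add: cop_harm_def)
  have "ln (1 / Y) \<le> 1 / Y - 1" using assms by (intro ln_le_minus_one) simp
  hence "- ln Y \<le> 1 / Y - 1" using assms by (simp add: ln_div)
  moreover have "ln Y \<le> 0" using True assms by simp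
  moreover have "1 / Y > 1" using True assms by simp
  moreover have "0 < (euler_mascheroni::real)" "(euler_mascheroni::real) < 13/22"
    using euler_mascheroni_pos euler_mascheroni_less_13_over_22 by auto
  ultimately show ?thesis unfolding 0 by linarith
next
  case False
  define n where "n = nat \<lfloor>Y\<rfloor>"
  have n: "n \<ge> 1" "real n \<le> Y" "Y < real n + 1" using False by (auto simp: n_def le_nat_floor)
  have "cop_upto {} Y = {1..n}" using n by (auto simp: cop_upto_def n_def le_nat_floor)
  hence c: "cop_harm {} Y = harm n" by (simp add: cop_harm_def harm_def inverse_eq_divide)
  have e: "harm n - ln (real (Suc n)) + inverse (real (2*(n+1))) \<le> (euler_mascheroni::real)"
     "(euler_mascheroni::real) \<le> harm n - ln (real (Suc n)) + inverse (real (2*n))"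
    using euler_mascheroni_bounds[OF n(1)] by auto
  have i: "0 \<le> inverse (real (2*(n+1)))" by simp
  have "ln (real (Suc n)) - ln Y = ln (real (Suc n) / Y)" using assms by (simp add: ln_div)
  also have "\<dots> \<le> real (Suc n) / Y - 1" using assms by (intro ln_le_minus_one) simp
  also have "\<dots> \<le> 1 / Y" using assms n by (simp add: field_simps)
  finally have "ln (real (Suc n)) - ln Y \<le> 1 / Y" .
  moreover have "ln Y - ln (real (Suc n)) = ln (Y / real (Suc n))" using assms by (simp add: ln_div)
  moreover have "\<dots> \<le> Y / real (Suc n) - 1" using assms by (intro ln_le_minus_one) simp
  moreover have "Y / real (Suc n) - 1 + inverse (real (2*n)) \<le> 1 / Y"
  proof -
    have "Y / real (Suc n) + inverse (real (2*n)) \<le> 1 + 1 / Y"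
    proof (cases "n = 1")
      case True
      have "0 \<le> (2 - Y) * (Y + 0) / 2 + (1 - Y/2)" using n True by auto
      hence "Y * Y / 2 + Y / 2 \<le> Y + 1" by (simp add: field_simps)
      thus ?thesis using True assms by (simp add: field_simps)
    next
      case False
      have "Y / real (Suc n) \<le> 1" using n by simp
      moreover have "Y \<le> 2 * real n" using n by simp
      hence "inverse (real (2*n)) \<le> 1 / Y" using assms n by (simp add: field_simps)
      ultimately show ?thesis by linarith
    qed
    thus ?thesis by linarith
  qed
  ultimately show ?thesis unfolding c using e i by linarith
qed

text \<open>Induction on the primes. Adjoining \<open>p\<close> subtracts 1 / p times the sum with
  cutoff Y / p. A main term A (ln Y + B) becomes (1 - 1 / p) A (ln Y + B + ln p / (p - 1)). The
  error doubles only, since the factor 1 / p compensates for the smaller cutoff.\<close>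

lemma cop_harm_bound:
  assumes "finite R" "\<And>r. r \<in> R \<Longrightarrow> prime r" "Y > 0"
  shows "\<bar>cop_harm R Y - (\<Prod>p\<in>R. 1 - 1 / real p) *
            (ln Y + euler_mascheroni + (\<Sum>p\<in>R. ln (real p) / (real p - 1)))\<bar> \<le> 2 ^ card R / Y"
  using assms
proof (induction R arbitrary: Y rule: finite_induct)
  case empty
  thus ?case using cop_harm_empty by simp
next
  case (insert p R)
  define A where "A = (\<Prod>p\<in>R. 1 - 1 / real p)"
  define B where "B = euler_mascheroni + (\<Sum>p\<in>R. ln (real p) / (real p - 1))"
  have p: "prime p" "real p > 1" using insert.prems prime_gt_1_nat by auto
  have 1: "\<bar>cop_harm R Y - A * (ln Y + B)\<bar> \<le> 2 ^ card R / Y"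
    using insert.IH[of Y] insert.prems by (simp add: A_def B_def add.assoc)
  have "\<bar>cop_harm R (Y / p) - A * (ln (Y / p) + B)\<bar> \<le> 2 ^ card R / (Y / p)"
    using insert.IH[of "Y / p"] insert.prems p by (simp add: A_def B_def add.assoc)
  hence "\<bar>cop_harm R (Y / p) - A * (ln (Y / p) + B)\<bar> / p \<le> 2 ^ card R / (Y / p) / p"
    using p by (intro divide_right_mono) auto
  also have "\<dots> = 2 ^ card R / Y" using p by simp
  also have "\<bar>cop_harm R (Y / p) - A * (ln (Y / p) + B)\<bar> / p =
     \<bar>cop_harm R (Y / p) / p - A * (ln Y - ln p + B) / p\<bar>"
  proof -
    have "\<bar>z\<bar> / p = \<bar>z / p\<bar>" for z :: real using p by simp
    thus ?thesis using p insert.prems by (simp only: ln_div diff_divide_distrib) (simp add: ln_div)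
  qed
  finally have 2: "\<bar>cop_harm R (Y / p) / p - A * (ln Y - ln p + B) / p\<bar> \<le> 2 ^ card R / Y" .
  have 3: "cop_harm (insert p R) Y = cop_harm R Y - cop_harm R (Y / p) / p"
    using insert by (intro cop_harm_insert) auto
  have 4: "(1 - 1 / p) * A * (ln Y + B + ln p / (real p - 1)) =
      A * (ln Y + B) - A * (ln Y - ln p + B) / p"
    using p by (simp add: divide_simps) (simp add: algebra_simps)
  have 5: "(2::real) ^ card (insert p R) / Y = 2 ^ card R / Y + 2 ^ card R / Y"
    using insert by simp
  have 6: "(\<Prod>p\<in>insert p R. 1 - 1 / real p) = (1 - 1 / p) * A"
    using insert by (simp add: A_def)
  have 7: "euler_mascheroni + (\<Sum>p\<in>insert p R. ln (real p) / (real p - 1)) = B + ln p / (real p - 1)"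
    using insert.hyps by (simp add: B_def)
  show ?case unfolding 3 5 6 add.assoc 7 using 1 2 4 unfolding add.assoc by linarith
qed

text \<open>The modulus of the Ramanujan sum of \<open>k\<close> to the modulus \<open>\<Prod>P\<close>.\<close>

definition sieve_weight :: "nat set \<Rightarrow> nat \<Rightarrow> real" where
  "sieve_weight P k = (\<Prod>p\<in>P. if p dvd k then real p - 1 else 1)"

lemma sieve_weight_nonneg: "(\<And>p. p \<in> P \<Longrightarrow> prime p) \<Longrightarrow> sieve_weight P k \<ge> 0"
  unfolding sieve_weight_def by (rule prod_nonneg) (use prime_ge_1_nat in force)

lemma sieve_weight_mult:
  assumes "\<And>r. r \<in> P \<Longrightarrow> prime r" "prime p" "p \<notin> P"
  shows "sieve_weight P (p * k) = sieve_weight P k"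
  unfolding sieve_weight_def
  by (rule prod.cong) (use assms prime_dvd_mult_prime_iff in auto)

text \<open>Adjoining \<open>p\<close> to \<open>P\<close> adds (p - 2) times the old weight at the
  multiples of \<open>p\<close>. After dividing them by \<open>p\<close>, these contribute at most
  (p - 2) / p times the old sum, and 1 + (p - 2) / p = 2 (p - 1) / p.\<close>

lemma sum_sieve_weight_le:
  assumes "finite P" "\<And>r. r \<in> P \<Longrightarrow> prime r" "\<And>r. r \<in> R \<Longrightarrow> prime r"
  shows "(\<Sum>k\<in>cop_upto R Y. sieve_weight P k / real k) \<le> (\<Prod>p\<in>P. 2 * (real p - 1) / real p) * cop_harm R Y"
  using assms(1,2)
proof (induction P arbitrary: Y rule: finite_induct)
  case empty
  show ?case by (simp add: sieve_weight_def cop_harm_def)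
next
  case (insert p P)
  define B where "B = (\<lambda>Y. \<Sum>k\<in>cop_upto R Y. sieve_weight P k / real k)"
  have p: "prime p" "real p \<ge> 2" using insert.prems prime_ge_2_nat by auto
  have nn: "sieve_weight P k \<ge> 0" for k using insert.prems by (intro sieve_weight_nonneg) auto
  have B0: "B Y \<ge> 0" for Y unfolding B_def by (intro sum_nonneg) (use nn in auto)
  have IH: "B Y \<le> (\<Prod>p\<in>P. 2 * (real p - 1) / real p) * cop_harm R Y"
    unfolding B_def using insert by auto
  have w: "sieve_weight (insert p P) k = sieve_weight P k + (if p dvd k then (real p - 2) * sieve_weight P k else 0)" for k
    using insert by (simp add: sieve_weight_def algebra_simps)
  have "(\<Sum>k\<in>cop_upto R Y. sieve_weight (insert p P) k / real k) =
     B Y + (\<Sum>k\<in>{k\<in>cop_upto R Y. p dvd k}. (real p - 2) * sieve_weight P k / real k)"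
    unfolding w B_def sum.inter_filter[OF finite_cop_upto] sum.distrib[symmetric]
    by (rule sum.cong) (auto simp: add_divide_distrib)
  also have "(\<Sum>k\<in>{k\<in>cop_upto R Y. p dvd k}. (real p - 2) * sieve_weight P k / real k) \<le> (real p - 2) / real p * B Y"
  proof (cases "p \<in> R")
    case True
    hence e: "{k\<in>cop_upto R Y. p dvd k} = {}" by (auto simp: cop_upto_def)
    show ?thesis unfolding e using p B0 by simp
  next
    case False
    have "(\<Sum>k\<in>{k\<in>cop_upto R Y. p dvd k}. (real p - 2) * sieve_weight P k / real k)
       = (\<Sum>k\<in>cop_upto R (Y / real p). (real p - 2) * sieve_weight P (p * k) / real (p * k))"
      by (rule sum_cop_upto_multiples) (use p assms False prime_dvd_mult_prime_iff prime_gt_0_nat in blast)+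
    also have "\<dots> = (real p - 2) / real p * B (Y / real p)"
      unfolding B_def sum_distrib_left
      by (rule sum.cong) (use p insert in \<open>auto simp: sieve_weight_mult\<close>)
    also have "\<dots> \<le> (real p - 2) / real p * B Y"
    proof (intro mult_left_mono)
      show "B (Y / real p) \<le> B Y" unfolding B_def
      proof (rule sum_mono2)
        \<comment> \<open>For negative \<open>Y\<close> the cutoff \<open>Y / p\<close> exceeds
          \<open>Y\<close>, but then both sets are empty.\<close>
        have "Y / real p < 1" if "Y < 0" using that p by (simp add: field_simps)
        moreover have "Y / real p \<le> Y" if "Y \<ge> 0" using that p by (simp add: field_simps mult_le_cancel_left1)
        ultimately show "cop_upto R (Y / real p) \<subseteq> cop_upto R Y" unfolding cop_upto_def by force
      qed (use nn in auto)
    qed (use p in simp)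
    finally show ?thesis .
  qed
  also have "B Y + (real p - 2) / real p * B Y = 2 * (real p - 1) / real p * B Y"
    using p by (simp add: field_simps)
  also have "\<dots> \<le> 2 * (real p - 1) / real p * ((\<Prod>p\<in>P. 2 * (real p - 1) / real p) * cop_harm R Y)"
    using p by (intro mult_left_mono IH) auto
  finally show ?case using insert by simp
qed

text \<open>With c = |cos t| the square of the left-hand side is (1 - c^2) (1 + c)^2. Its maximum
  27/16 is attained at c = 1/2, which is why (c - 1/2)^2 splits off from the difference.\<close>

lemma sin_plus_half_sin_double_le: "\<bar>sin t\<bar> + \<bar>sin (2 * t)\<bar> / 2 \<le> 3 * sqrt 3 / 4" for t :: real
proof -
  define c where "c = \<bar>cos t\<bar>"
  have c: "0 \<le> c" "c \<le> 1" by (auto simp: c_def)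
  have s: "\<bar>sin t\<bar> ^ 2 = 1 - c ^ 2" by (simp add: c_def sin_squared_eq)
  have "\<bar>sin t\<bar> + \<bar>sin (2 * t)\<bar> / 2 = \<bar>sin t\<bar> * (1 + c)"
    unfolding sin_double by (simp add: abs_mult c_def algebra_simps)
  moreover have "(\<bar>sin t\<bar> * (1 + c))\<^sup>2 \<le> (3 * sqrt 3 / 4)\<^sup>2"
  proof -
    have "(\<bar>sin t\<bar> * (1 + c))\<^sup>2 = (1 - c\<^sup>2) * (1 + c)\<^sup>2" by (simp only: power_mult_distrib s)
    moreover have "27/16 - (1 - c\<^sup>2) * (1 + c)\<^sup>2 = (c - 1/2)\<^sup>2 * (c\<^sup>2 + 3 * c + 11/4)"
      by (simp add: power2_eq_square algebra_simps) 
    moreover have "(c - 1/2)\<^sup>2 * (c\<^sup>2 + 3 * c + 11/4) \<ge> 0" using c by simp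
    moreover have "(3 * sqrt 3 / 4)\<^sup>2 = (27/16::real)" by (simp add: power_mult_distrib power_divide)
    ultimately show ?thesis by linarith
  qed
  ultimately show ?thesis using power2_le_imp_le by fastforce
qed

text \<open>By the cubic Taylor bound for the sine it suffices that 1/2 - y / 6 - y^2 / 12 is
  nonnegative. This still holds at y = 1.6, slightly above pi / 2.\<close>

lemma inverse_sin_le:
  assumes "0 < y" "y \<le> pi / 2"
  shows "1 / sin y \<le> 1 / y + 1 / (2::real)"
proof -
  have "y < 2" using assms pi_less_4 by linarith
  have y16: "y \<le> 1.6" using assms pi_approx by simp
  have s: "sin y \<ge> y - y ^ 3 / 6"
    using Maclaurin_sin_bound[of y 3] assms by (simp add: sin_coeff_def eval_nat_numeral field_simps abs_if split: if_splits)
  have y2: "y\<^sup>2 \<le> 2.56" using power_mono[OF y16, of 2] assms by (simp add: power2_eq_square)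
  have pos: "y - y ^ 3 / 6 > 0"
  proof -
    have "y - y ^ 3 / 6 = y * (1 - y\<^sup>2 / 6)" by (simp add: power2_eq_square power3_eq_cube algebra_simps)
    thus ?thesis using assms y2 by simp
  qed
  have "(1 / y + 1 / 2) * (y - y ^ 3 / 6) = 1 + y * (1/2 - y / 6 - y\<^sup>2 / 12)"
    using assms by (simp add: power2_eq_square power3_eq_cube field_simps)
  also have "\<dots> \<ge> 1" using assms y16 y2 by simp
  finally have "1 \<le> (1 / y + 1 / 2) * (y - y ^ 3 / 6)" .
  also have "\<dots> \<le> (1 / y + 1 / 2) * sin y" using s assms by (intro mult_left_mono) auto
  finally show ?thesis using s pos by (simp add: pos_divide_le_eq)
qed

section \<open>Characters and Gauss sums\<close>

lemma periodic_mod: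
  fixes h :: "int \<Rightarrow> 'a"
  assumes "\<And>a. h (a + int q) = h a"
  shows "h (a mod int q) = h a"
proof -
  have n: "h (b + int n * int q) = h b" for b n
  proof (induction n)
    case (Suc n)
    have "h (b + int (Suc n) * int q) = h ((b + int n * int q) + int q)" by (simp add: algebra_simps)
    thus ?case using assms Suc by simp
  qed simp
  have z: "h (b + m * int q) = h b" for b m
  proof (cases "m \<ge> 0")
    case True
    thus ?thesis using n[of b "nat m"] by simp
  next
    case False
    thus ?thesis using n[of "b + m * int q" "nat (- m)"] by (simp add: algebra_simps)
  qed
  show ?thesis using z[of "a mod int q" "a div int q"] by simp
qed

text \<open>Injectivity modulo \<open>q\<close> makes \<open>g\<close> a permutation of the
  residues. Shifts and multiplication by units are the two cases in use.\<close>

lemma sum_periodic_reindex: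
  fixes h :: "int \<Rightarrow> 'a :: comm_monoid_add"
  assumes "q > 0" and h: "\<And>a. h (a + int q) = h a"
    and g: "\<And>a b. [g a = g b] (mod int q) \<Longrightarrow> [a = b] (mod int q)"
  shows "(\<Sum>a\<in>{0..<int q}. h (g a)) = (\<Sum>a\<in>{0..<int q}. h a)"
proof -
  let ?g = "\<lambda>a. g a mod int q"
  have inj: "inj_on ?g {0..<int q}"
  proof (rule inj_onI)
    fix a b assume ab: "a \<in> {0..<int q}" "b \<in> {0..<int q}" "?g a = ?g b"
    have "[a = b] (mod int q)" by (rule g) (use ab in \<open>simp add: cong_def\<close>)
    thus "a = b" using ab by (auto simp: cong_def)
  qed
  have sub: "?g ` {0..<int q} \<subseteq> {0..<int q}" using assms(1) by auto
  have "?g ` {0..<int q} = {0..<int q}"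
    by (rule card_subset_eq) (use sub inj in \<open>auto simp: card_image\<close>)
  hence "(\<Sum>a\<in>{0..<int q}. h a) = (\<Sum>a\<in>{0..<int q}. h (?g a))"
    using sum.reindex[OF inj, of h] by simp
  also have "\<dots> = (\<Sum>a\<in>{0..<int q}. h (g a))" by (simp only: periodic_mod[of h, OF h])
  finally show ?thesis ..
qed

lemma sum_periodic_shift:
  fixes h :: "int \<Rightarrow> 'a :: comm_monoid_add"
  assumes "q > 0" "\<And>a. h (a + int q) = h a"
  shows "(\<Sum>a\<in>{0..<int q}. h (a + c)) = (\<Sum>a\<in>{0..<int q}. h a)"
  using assms by (rule sum_periodic_reindex) (auto simp: cong_add_rcancel)

lemma sum_periodic_mult:
  fixes h :: "int \<Rightarrow> 'a :: comm_monoid_add"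
  assumes "q > 0" "\<And>a. h (a + int q) = h a" "coprime u (int q)"
  shows "(\<Sum>a\<in>{0..<int q}. h (u * a)) = (\<Sum>a\<in>{0..<int q}. h a)"
  using assms(1,2) by (rule sum_periodic_reindex) (use assms(3) in \<open>auto simp: cong_mult_lcancel\<close>)

section \<open>Additive characters and their orthogonality\<close>

definition add_char :: "nat \<Rightarrow> int \<Rightarrow> complex" where
  "add_char q a = cis (2 * pi * (real_of_int a / real q))"

lemma add_char_0 [simp]: "add_char q 0 = 1"
  by (simp add: add_char_def)

lemma add_char_add: "add_char q (a + b) = add_char q a * add_char q b"
  unfolding add_char_def cis_mult by (simp only: of_int_add add_divide_distrib distrib_left)

lemma cnj_add_char: "cnj (add_char q a) = add_char q (- a)"
  by (simp add: add_char_def cis_cnj)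

lemma norm_add_char [simp]: "cmod (add_char q a) = 1"
  by (simp add: add_char_def)

lemma add_char_mult: "q > 0 \<Longrightarrow> add_char q (int q * a) = 1"
  by (simp add: add_char_def)

lemma add_char_periodic_mult: "q > 0 \<Longrightarrow> add_char q ((a + int q) * k) = add_char q (a * k)"
  using add_char_mult[of q k] by (simp only: add_char_add distrib_right mult_1_right)

lemma add_char_cancel: "p > 0 \<Longrightarrow> add_char (p * q) (int p * a) = add_char q a"
  unfolding add_char_def by (simp only: of_int_mult of_nat_mult of_int_of_nat_eq) simp

lemma add_char_eq_1_iff:
  assumes "q > 0"
  shows "add_char q a = 1 \<longleftrightarrow> int q dvd a"
proof
  assume "add_char q a = 1"
  hence "cos (2 * pi * (real_of_int a / real q)) = 1" by (simp add: add_char_def complex_eq_iff)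
  then obtain n :: int where "2 * pi * (real_of_int a / real q) = real_of_int n * 2 * pi"
    using cos_one_2pi_int by blast
  hence "2 * pi * (real_of_int a / real q) = 2 * pi * real_of_int n" by (simp add: mult_ac)
  hence "real_of_int a / real q = real_of_int n" using pi_neq_zero by (simp only: mult_cancel_left) simp
  hence "real_of_int a = real_of_int (n * int q)" using assms by (simp add: field_simps)
  hence "a = n * int q" by (simp only: of_int_eq_iff)
  thus "int q dvd a" by simp
qed (use assms add_char_mult in auto)

text \<open>If \<open>q\<close> does not divide \<open>k\<close>, shifting \<open>a\<close> by 1
  multiplies the sum by \<open>add_char q k\<close>, which differs from 1, yet leaves it
  unchanged.\<close>

lemma sum_add_char:
  assumes "q > 0"
  shows "(\<Sum>a\<in>{0..<int q}. add_char q (a * k)) = (if int q dvd k then of_nat q else 0)"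
proof (cases "int q dvd k")
  case True
  then obtain j where "k = int q * j" by auto
  hence "add_char q (a * k) = 1" for a using add_char_mult[OF assms, of "a * j"] by (simp add: algebra_simps)
  thus ?thesis using True by simp
next
  case False
  let ?S = "\<Sum>a\<in>{0..<int q}. add_char q (a * k)"
  have "(\<Sum>a\<in>{0..<int q}. add_char q ((a + 1) * k)) = ?S"
    by (rule sum_periodic_shift[OF assms]) (rule add_char_periodic_mult[OF assms])
  moreover have "add_char q k * ?S = (\<Sum>a\<in>{0..<int q}. add_char q ((a + 1) * k))"
    unfolding sum_distrib_left
    by (rule sum.cong) (simp_all only: distrib_right add_char_add mult_1 mult.commute[of "add_char q k"])
  ultimately have "add_char q k * ?S = ?S" by simp
  hence "?S = 0" using False add_char_eq_1_iff[OF assms] by auto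
  thus ?thesis using False by simp
qed

section \<open>Gauss sums as discrete Fourier transforms: multiplicativity, inversion,
  Parseval\<close>

definition gauss_sum :: "(int \<Rightarrow> complex) \<Rightarrow> nat \<Rightarrow> int \<Rightarrow> complex" where
  "gauss_sum f q k = (\<Sum>a\<in>{0..<int q}. f a * add_char q (a * k))"

lemma dirichlet_characterD:
  assumes "dirichlet_character q f"
  shows "f (a + int q) = f a" "f (a * b) = f a * f b" "f a = 0 \<longleftrightarrow> \<not> coprime a (int q)"
  using assms by (auto simp: dirichlet_character_def)

lemma dirichlet_character_cong:
  assumes "dirichlet_character q f" "[a = b] (mod int q)"
  shows "f a = f b"
proof -
  have "f (a mod int q) = f (b mod int q)" using assms(2) by (simp only: cong_def)
  thus ?thesis by (simp only: periodic_mod[of f q, OF dirichlet_characterD(1)[OF assms(1)]])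
qed

lemma dirichlet_character_1:
  assumes "dirichlet_character q f"
  shows "f 1 = 1"
proof -
  have "f 1 = f 1 * f 1" using dirichlet_characterD(2)[OF assms, of 1 1] by simp
  moreover have "f 1 \<noteq> 0" using dirichlet_characterD(3)[OF assms, of 1] by simp
  ultimately show ?thesis by simp
qed

text \<open>By Euler's theorem the values at units are roots of unity.\<close>

lemma dirichlet_character_norm:
  assumes "dirichlet_character q f" "q > 0"
  shows "cmod (f a) = (if coprime a (int q) then 1 else 0)"
proof (cases "coprime a (int q)")
  case True
  define n where "n = nat (a mod int q)"
  have n: "int n = a mod int q" using assms(2) by (simp add: n_def)
  have fa: "f a = f (int n)" by (rule dirichlet_character_cong[OF assms(1)]) (simp add: n)
  have "coprime (int n) (int q)" using True assms(2) by (simp add: n)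
  hence "[n ^ totient q = 1] (mod q)" by (intro euler_theorem) simp
  hence "[int n ^ totient q = 1] (mod int q)" by (metis cong_int_iff of_nat_1 of_nat_power)
  hence "f (int n ^ totient q) = 1"
    using dirichlet_character_cong[OF assms(1)] dirichlet_character_1[OF assms(1)] by metis
  moreover have "f (int n ^ m) = f (int n) ^ m" for m
    by (induction m) (simp_all add: dirichlet_character_1[OF assms(1)] dirichlet_characterD(2)[OF assms(1)])
  ultimately have "f a ^ totient q = 1" by (simp add: fa)
  hence "cmod (f a) ^ totient q = 1" by (metis norm_power norm_one)
  moreover have "totient q > 0" using assms by simp
  ultimately show ?thesis using True by (metis norm_ge_zero power_eq_1_iff less_numeral_extra(3) real_norm_def abs_of_nonneg)
qed (use dirichlet_characterD(3)[OF assms(1)] in auto)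

text \<open>Substitute \<open>u * a\<close> for the summation variable.\<close>

lemma gauss_sum_mult:
  assumes "dirichlet_character q f" "q > 0" "coprime u (int q)"
  shows "f u * gauss_sum f q (u * k) = gauss_sum f q k"
proof -
  have "gauss_sum f q k = (\<Sum>a\<in>{0..<int q}. f (u * a) * add_char q ((u * a) * k))"
    unfolding gauss_sum_def
    by (rule sum_periodic_mult[where h = "\<lambda>a. f a * add_char q (a * k)", symmetric, OF assms(2) _ assms(3)])
       (simp only: dirichlet_characterD(1)[OF assms(1)] add_char_periodic_mult[OF assms(2)])
  also have "\<dots> = f u * gauss_sum f q (u * k)"
    unfolding gauss_sum_def sum_distrib_left
    by (rule sum.cong) (simp_all only: dirichlet_characterD(2)[OF assms(1)] mult_ac)
  finally show ?thesis ..
qed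

lemma gauss_sum_periodic:
  assumes "q > 0"
  shows "gauss_sum f q (k + int q) = gauss_sum f q k"
proof -
  have "add_char q (a * (k + int q)) = add_char q (a * k)" for a
    using add_char_periodic_mult[OF assms, of k a] by (simp only: mult.commute[of a])
  thus ?thesis by (simp only: gauss_sum_def)
qed

lemma norm_gauss_sum_mult:
  assumes "dirichlet_character q f" "q > 0" "coprime u (int q)"
  shows "cmod (gauss_sum f q (u * k)) = cmod (gauss_sum f q k)"
proof -
  have "cmod (f u) * cmod (gauss_sum f q (u * k)) = cmod (gauss_sum f q k)"
    by (simp only: norm_mult[symmetric] gauss_sum_mult[OF assms])
  thus ?thesis using dirichlet_character_norm[OF assms(1,2), of u] assms(3) by simp
qed

text \<open>After exchanging the sums, orthogonality of the additive characters singles out the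
  residue of \<open>m\<close>.\<close>

lemma gauss_sum_inversion:
  assumes "q > 0" "\<And>a. f (a + int q) = f a"
  shows "(\<Sum>k\<in>{0..<int q}. gauss_sum f q k * add_char q (- (k * m))) = of_nat q * f m"
proof -
  have "(\<Sum>k\<in>{0..<int q}. gauss_sum f q k * add_char q (- (k * m)))
     = (\<Sum>k\<in>{0..<int q}. \<Sum>a\<in>{0..<int q}. f a * add_char q (k * (a - m)))"
    unfolding gauss_sum_def sum_distrib_right
  proof (intro sum.cong refl)
    fix k a
    have "k * (a - m) = a * k + - (k * m)" by (simp add: algebra_simps)
    thus "f a * add_char q (a * k) * add_char q (- (k * m)) = f a * add_char q (k * (a - m))"
      by (simp only: add_char_add mult.assoc)
  qed
  also have "\<dots> = (\<Sum>a\<in>{0..<int q}. f a * (\<Sum>k\<in>{0..<int q}. add_char q (k * (a - m))))"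
    by (subst sum.swap) (simp add: sum_distrib_left)
  also have "\<dots> = (\<Sum>a\<in>{0..<int q}. if a = m mod int q then f a * of_nat q else 0)"
  proof (rule sum.cong)
    fix a assume "a \<in> {0..<int q}"
    hence "int q dvd a - m \<longleftrightarrow> a = m mod int q"
      by (metis atLeastLessThan_iff mod_eq_dvd_iff mod_pos_pos_trivial)
    thus "f a * (\<Sum>k\<in>{0..<int q}. add_char q (k * (a - m))) = (if a = m mod int q then f a * of_nat q else 0)"
      by (simp add: sum_add_char[OF assms(1)])
  qed simp
  also have "\<dots> = of_nat q * f m" using assms by (simp add: periodic_mod)
  finally show ?thesis .
qed

text \<open>Parseval's identity: expanding only the conjugate in |G|^2 = G * cnj G makes the
  inversion formula applicable to the inner sum over \<open>k\<close>.\<close>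

lemma sum_norm_gauss_sum_sq:
  assumes "q > 0" "\<And>a. f (a + int q) = f a"
  shows "(\<Sum>k\<in>{0..<int q}. (cmod (gauss_sum f q k))\<^sup>2) = real q * (\<Sum>a\<in>{0..<int q}. (cmod (f a))\<^sup>2)"
proof -
  have "complex_of_real (\<Sum>k\<in>{0..<int q}. (cmod (gauss_sum f q k))\<^sup>2)
    = (\<Sum>k\<in>{0..<int q}. gauss_sum f q k * cnj (gauss_sum f q k))"
    by (simp only: of_real_sum complex_norm_square)
  also have "\<dots> = (\<Sum>k\<in>{0..<int q}. \<Sum>a\<in>{0..<int q}. cnj (f a) * (gauss_sum f q k * add_char q (- (k * a))))"
  proof (intro sum.cong refl)
    fix k
    have "cnj (gauss_sum f q k) = (\<Sum>a\<in>{0..<int q}. cnj (f a) * add_char q (- (k * a)))"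
      unfolding gauss_sum_def cnj_sum complex_cnj_mult cnj_add_char by (simp only: mult.commute[of k])
    thus "gauss_sum f q k * cnj (gauss_sum f q k) =
        (\<Sum>a\<in>{0..<int q}. cnj (f a) * (gauss_sum f q k * add_char q (- (k * a))))"
      by (simp only: sum_distrib_left mult.left_commute)
  qed
  also have "\<dots> = (\<Sum>a\<in>{0..<int q}. cnj (f a) * (\<Sum>k\<in>{0..<int q}. gauss_sum f q k * add_char q (- (k * a))))"
    by (subst sum.swap) (simp add: sum_distrib_left)
  also have "\<dots> = (\<Sum>a\<in>{0..<int q}. cnj (f a) * (of_nat q * f a))"
    by (simp only: gauss_sum_inversion[of q f, OF assms])
  also have "\<dots> = complex_of_real (real q * (\<Sum>a\<in>{0..<int q}. (cmod (f a))\<^sup>2))"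
    unfolding of_real_mult of_real_sum complex_norm_square sum_distrib_left
    by (intro sum.cong refl) (simp only: of_real_of_nat_eq mult_ac)
  finally show ?thesis by (simp only: of_real_eq_iff)
qed

lemma card_coprime_residues:
  assumes "q > 1"
  shows "card {a\<in>{0..<int q}. coprime a (int q)} = totient q"
proof -
  have "{a\<in>{0..<int q}. coprime a (int q)} = int ` totatives q"
  proof (intro equalityI subsetI)
    fix a assume a: "a \<in> {a\<in>{0..<int q}. coprime a (int q)}"
    then obtain n where n: "a = int n" by (auto elim: nonneg_int_cases)
    have "n \<noteq> 0" using a assms n by (intro notI) simp
    hence "n \<in> totatives q" using a n by (auto simp: totatives_def)
    thus "a \<in> int ` totatives q" using n by blast
  next
    fix a assume "a \<in> int ` totatives q"
    thus "a \<in> {a\<in>{0..<int q}. coprime a (int q)}" using assms totatives_less by (auto simp: totatives_def)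
  qed
  thus ?thesis by (simp add: card_image totient_def)
qed

lemma card_coprime_interval: "card {a\<in>{1..q}. coprime a q} = totient q"
proof -
  have "{a\<in>{1..q}. coprime a q} = totatives q" by (auto simp: totatives_def)
  thus ?thesis by (simp add: totient_def)
qed

section \<open>Primitive characters\<close>

text \<open>Surjectivity of reduction from units modulo \<open>d\<close> to units modulo
  \<open>e\<close>. The lift is b + K e, where K is the product of the primes of \<open>d\<close>
  not dividing \<open>b\<close>. Each prime of \<open>d\<close> divides exactly one of the summands
  b and K e.\<close>

lemma coprime_lift:
  fixes b d e :: int
  assumes "coprime b e" "e dvd d" "d > 0"
  shows "\<exists>c. coprime c d \<and> [c = b] (mod e)"
proof -
  define K where "K = \<Prod>{p\<in>prime_factors d. \<not> p dvd b}"
  define c where "c = b + K * e"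
  have "coprime c d"
  proof (rule ccontr)
    assume "\<not> coprime c d"
    then obtain x where x: "x dvd c" "x dvd d" "\<not> is_unit x" by (auto elim: not_coprimeE)
    moreover have "x \<noteq> 0" using x assms by auto
    ultimately obtain p where p: "prime p" "p dvd c" "p dvd d"
      using prime_divisor_exists[of x] by (meson dvd_trans)
    have K: "p dvd K \<longleftrightarrow> \<not> p dvd b"
    proof
      assume "p dvd K"
      then obtain r where "r \<in> prime_factors d" "\<not> r dvd b" "p dvd r"
        unfolding K_def using p by (auto simp: prime_dvd_prod_iff)
      thus "\<not> p dvd b" using p by (metis in_prime_factors_imp_prime primes_dvd_imp_eq)
    next
      assume "\<not> p dvd b"
      thus "p dvd K" unfolding K_def using p assms by (intro dvd_prodI) (auto simp: prime_factors_dvd)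
    qed
    show False
    proof (cases "p dvd b")
      case True
      hence "p dvd K * e" using p by (simp add: c_def dvd_add_right_iff)
      hence "p dvd e" using K True p by (simp add: prime_dvd_mult_iff)
      thus False using True assms(1) p by (meson coprime_common_divisor not_prime_unit)
    next
      case False
      hence "p dvd K" using K by simp
      thus False using p False by (simp add: c_def dvd_add_left_iff)
    qed
  qed
  moreover have "[c = b] (mod e)" by (simp add: c_def cong_iff_dvd_diff)
  ultimately show ?thesis by blast
qed

text \<open>A character that is trivial on the kernel of the reduction of units modulo
  \<open>d\<close> to units modulo \<open>e\<close> factors through this reduction. The new
  character is the value of \<open>f\<close> at a chosen lift.\<close>

lemma dirichlet_character_descend:
  assumes f: "dirichlet_character d f" and e: "e dvd d" "d > 0"
    and triv: "\<And>u. coprime u (int d) \<Longrightarrow> [u = 1] (mod int e) \<Longrightarrow> f u = 1"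
  shows "\<exists>f'. dirichlet_character e f' \<and> (\<forall>a. coprime a (int d) \<longrightarrow> f' a = f a)"
proof -
  have ed: "int e dvd int d" "int d > 0" using e by auto
  define lift where "lift = (\<lambda>b. SOME c. coprime c (int d) \<and> [c = b] (mod int e))"
  define f' where "f' = (\<lambda>b. if coprime b (int e) then f (lift b) else 0)"
  have lift: "coprime (lift b) (int d)" "[lift b = b] (mod int e)" if "coprime b (int e)" for b
    using someI_ex[OF coprime_lift[OF that ed]] by (auto simp: lift_def)
  \<comment> \<open>Independence of the choice of lift: with \<open>v\<close> inverse to
    \<open>c\<close> modulo \<open>d\<close>, the product \<open>lift b * v\<close> lies in the
    kernel.\<close>
  have f'_eq: "f' b = f c" if c: "coprime c (int d)" "[c = b] (mod int e)" for b c
  proof -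
    have "coprime c (int e)" using c ed by (meson coprime_divisors dvd_refl)
    hence b: "coprime b (int e)" using c(2) cong_imp_coprime by blast
    obtain v where v: "[c * v = 1] (mod int d)" using c(1) cong_solve_coprime_int by blast
    hence v': "coprime v (int d)" using coprime_iff_invertible_int by (metis mult.commute)
    have "[c * v = 1] (mod int e)" using v ed(1) cong_dvd_modulus by blast
    moreover have "[lift b * v = c * v] (mod int e)"
      using lift(2)[OF b] c(2) by (intro cong_mult cong_refl) (metis cong_sym cong_trans)
    ultimately have 1: "[lift b * v = 1] (mod int e)" by (metis cong_trans)
    have "f (lift b * v) = 1" using lift(1)[OF b] v' 1 by (intro triv) auto
    moreover have "f (c * v) = 1"
      using dirichlet_character_cong[OF f v] dirichlet_character_1[OF f] by simp
    ultimately have "f (lift b) * f v = f c * f v" by (simp add: dirichlet_characterD(2)[OF f])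
    moreover have "f v \<noteq> 0" using v' dirichlet_characterD(3)[OF f] by blast
    ultimately show ?thesis using b by (simp add: f'_def)
  qed
  have nz: "f' b \<noteq> 0 \<longleftrightarrow> coprime b (int e)" for b
    using lift(1) dirichlet_characterD(3)[OF f] by (auto simp: f'_def)
  have per: "f' (a + int e) = f' a" for a
  proof (cases "coprime a (int e)")
    case True
    have "[lift a = a + int e] (mod int e)" using lift(2)[OF True] by (simp add: cong_def)
    thus ?thesis using f'_eq[OF lift(1)[OF True]] lift(2)[OF True] by metis
  next
    case False
    hence "\<not> coprime (a + int e) (int e)" by (simp add: coprime_iff_gcd_eq_1)
    thus ?thesis using False nz by metis
  qed
  have mult: "f' (a * b) = f' a * f' b" for a b
  proof (cases "coprime a (int e) \<and> coprime b (int e)")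
    case True
    have "f' (a * b) = f (lift a * lift b)"
      by (rule f'_eq) (use True lift in \<open>auto intro: cong_mult\<close>)
    thus ?thesis using True by (simp add: f'_def dirichlet_characterD(2)[OF f])
  next
    case False
    hence "\<not> coprime (a * b) (int e)" by simp
    thus ?thesis using False nz by (metis mult_eq_0_iff)
  qed
  have "dirichlet_character e f'" using nz per mult by (simp add: dirichlet_character_def)
  moreover have "f' a = f a" if "coprime a (int d)" for a using f'_eq[OF that] by simp
  ultimately show ?thesis by blast
qed

text \<open>Primitivity is recorded as the vanishing of the Gauss sum at all frequencies sharing a
  factor with the modulus, the form needed for computing the moduli of the Gauss sums.\<close>

lemma exists_primitive_character:
  assumes \<chi>: "dirichlet_character q \<chi>" and q: "q > 0"
  shows "\<exists>d f. d > 0 \<and> d dvd q \<and> dirichlet_character d f \<and>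
           (\<forall>a. coprime a (int q) \<longrightarrow> \<chi> a = f a) \<and>
           (\<forall>k. \<not> coprime k (int d) \<longrightarrow> gauss_sum f d k = 0)"
proof -
  let ?P = "\<lambda>d. d > 0 \<and> d dvd q \<and> (\<exists>f. dirichlet_character d f \<and> (\<forall>a. coprime a (int q) \<longrightarrow> \<chi> a = f a))"
  define d where "d = (LEAST d. ?P d)"
  have "?P q" using assms by auto
  hence Pd: "?P d" unfolding d_def by (rule LeastI)
  then obtain f where f: "dirichlet_character d f" "\<And>a. coprime a (int q) \<Longrightarrow> \<chi> a = f a" by blast
  have d: "d > 0" "d dvd q" using Pd by auto
  text \<open>If the Gauss sum at \<open>k\<close> is nonzero, then \<open>f\<close> is trivial on the units congruent to 1 modulo
    \<open>d div gcd k d\<close>, so \<open>f\<close> descends to this modulus, which contradicts the minimality of \<open>d\<close>.\<close>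
  have "gauss_sum f d k = 0" if k: "\<not> coprime k (int d)" for k
  proof (rule ccontr)
    assume G: "gauss_sum f d k \<noteq> 0"
    define g where "g = nat (gcd k (int d))"
    have g: "int g = gcd k (int d)" by (simp add: g_def)
    have "g dvd d" using g by (metis gcd_dvd2 int_dvd_int_iff)
    then obtain e where e: "d = g * e" by auto
    obtain k' where k': "k = int g * k'" using g by (metis dvdE gcd_dvd1)
    have "g \<noteq> 1" using k g by (metis coprime_iff_gcd_eq_1 of_nat_1)
    moreover have "g > 0" "e > 0" using e d by (cases g; cases e; simp)+
    ultimately have lt: "e < d" using e by simp
    have "f u = 1" if u: "coprime u (int d)" "[u = 1] (mod int e)" for u
    proof -
      have "int e dvd u - 1" using u(2) by (simp add: cong_iff_dvd_diff)
      hence "int d dvd (u - 1) * k" unfolding e k' by (auto elim!: dvdE)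
      hence "[u * k = k] (mod int d)" by (simp add: cong_iff_dvd_diff algebra_simps)
      hence "gauss_sum f d (u * k) = gauss_sum f d k"
        by (metis periodic_mod[of "gauss_sum f d" d, OF gauss_sum_periodic[OF d(1)]] cong_def)
      thus ?thesis using gauss_sum_mult[OF f(1) d(1) u(1), of k] G by simp
    qed
    then obtain f' where f': "dirichlet_character e f'" "\<And>a. coprime a (int d) \<Longrightarrow> f' a = f a"
      using dirichlet_character_descend[OF f(1) _ d(1), of e] e by auto
    have "\<chi> a = f' a" if "coprime a (int q)" for a
    proof -
      have "coprime a (int d)" using that d(2) by (meson coprime_divisors dvd_refl int_dvd_int_iff)
      thus ?thesis using f(2)[OF that] f'(2) by simp
    qed
    moreover have "e dvd q" using e d(2) by (metis dvd_mult_right)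
    ultimately have "?P e" using f'(1) \<open>e > 0\<close> by blast
    thus False using lt not_less_Least unfolding d_def by blast
  qed
  thus ?thesis using f d by blast
qed

text \<open>The modulus is constant on units and vanishes elsewhere, so Parseval's identity reads
  phi(d) |G(1)|^2 = d phi(d).\<close>

lemma norm_gauss_sum_primitive:
  assumes f: "dirichlet_character d f" "d > 1"
    and prim: "\<And>k. \<not> coprime k (int d) \<Longrightarrow> gauss_sum f d k = 0"
  shows "cmod (gauss_sum f d k) = (if coprime k (int d) then sqrt (real d) else 0)"
proof -
  have d: "d > 0" using f(2) by simp
  have c: "cmod (gauss_sum f d k) = (if coprime k (int d) then cmod (gauss_sum f d 1) else 0)" for k
    using norm_gauss_sum_mult[OF f(1) d, of k 1] prim by simp
  have "(\<Sum>k\<in>{0..<int d}. (cmod (gauss_sum f d k))\<^sup>2)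
     = (\<Sum>k\<in>{a\<in>{0..<int d}. coprime a (int d)}. (cmod (gauss_sum f d 1))\<^sup>2)"
    unfolding sum.inter_filter[OF finite_atLeastLessThan_int]
    by (rule sum.cong[OF refl]) (subst c, simp)
  also have "\<dots> = real (totient d) * (cmod (gauss_sum f d 1))\<^sup>2"
    using card_coprime_residues[OF f(2)] by simp
  also have "(\<Sum>k\<in>{0..<int d}. (cmod (gauss_sum f d k))\<^sup>2) = real d * (\<Sum>a\<in>{0..<int d}. (cmod (f a))\<^sup>2)"
    by (rule sum_norm_gauss_sum_sq[OF d]) (rule dirichlet_characterD(1)[OF f(1)])
  also have "(\<Sum>a\<in>{0..<int d}. (cmod (f a))\<^sup>2) = (\<Sum>a\<in>{a\<in>{0..<int d}. coprime a (int d)}. 1)"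
    unfolding sum.inter_filter[OF finite_atLeastLessThan_int]
    by (rule sum.cong) (simp_all add: dirichlet_character_norm[OF f(1) d])
  also have "\<dots> = real (totient d)" using card_coprime_residues[OF f(2)] by simp
  finally have "(cmod (gauss_sum f d 1))\<^sup>2 = real d" using d by simp
  hence "cmod (gauss_sum f d 1) = sqrt (real d)" by (metis norm_ge_zero real_sqrt_unique)
  thus ?thesis using c[of k] by simp
qed

section \<open>Sieving a character by further primes\<close>

lemma sum_residue_decompose:
  fixes h :: "int \<Rightarrow> 'a :: comm_monoid_add"
  assumes "p > 0" "q > 0"
  shows "(\<Sum>a\<in>{0..<int (p * q)}. h a) = (\<Sum>b\<in>{0..<int q}. \<Sum>j\<in>{0..<int p}. h (b + int q * j))"
  unfolding sum.cartesian_product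
proof (rule sum.reindex_bij_witness[of _ "\<lambda>(b, j). b + int q * j" "\<lambda>a. (a mod int q, a div int q)"])
  fix a assume "a \<in> {0..<int (p * q)}"
  moreover have "a div int q < int p" if "a < int p * int q"
  proof -
    have "int q * (a div int q) + a mod int q = a" by simp
    moreover have "a mod int q \<ge> 0" using assms by simp
    ultimately have "int q * (a div int q) < int q * int p" using that by (simp only: mult.commute[of "int q" "int p"])
    thus ?thesis using assms by (simp only: mult_less_cancel_left_pos of_nat_0_less_iff)
  qed
  ultimately show "(a mod int q, a div int q) \<in> {0..<int q} \<times> {0..<int p}"
    using assms by (auto simp: pos_imp_zdiv_nonneg_iff)
next
  fix x assume x: "x \<in> {0..<int q} \<times> {0..<int p}"
  obtain b j where bj: "x = (b, j)" by force
  have "int q * (j + 1) \<le> int q * int p" using x bj by (intro mult_left_mono) auto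
  thus "(case x of (b, j) \<Rightarrow> b + int q * j) \<in> {0..<int (p * q)}"
    using x bj by (auto simp: algebra_simps)
  have "(b + int q * j) mod int q = b" "(b + int q * j) div int q = j" using x bj by auto
  thus "(\<lambda>a. (a mod int q, a div int q)) (case x of (b, j) \<Rightarrow> b + int q * j) = x" using bj by simp
next
  fix a
  have "a mod int q + int q * (a div int q) = a" by simp
  thus "(case (a mod int q, a div int q) of (b, j) \<Rightarrow> b + int q * j) = a"
    "(case (a mod int q, a div int q) of (b, j) \<Rightarrow> h (b + int q * j)) = h a" by simp_all
qed

text \<open>The multiples of \<open>p\<close> are subtracted from the full sum. They contribute f(p)
  G(k), because the factor \<open>p\<close> cancels in the additive character. In the full sum,
  writing a = b + q j leaves an inner sum over j that is p or 0. If k = p l, the full sum is p G(l)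
  = p f(p) G(k).\<close>

lemma gauss_sum_remove_prime:
  assumes f: "dirichlet_character q f" "q > 0" and p: "prime p" "\<not> p dvd q"
  defines "f' \<equiv> (\<lambda>a. if int p dvd a then 0 else f a)"
  shows "gauss_sum f' (p * q) k = (if int p dvd k then of_nat p - 1 else - 1) * (f (int p) * gauss_sum f q k)"
proof -
  have p0: "p > 0" using p prime_gt_0_nat by blast
  have cop: "coprime (int p) (int q)" using p by (simp add: prime_imp_coprime)
  let ?e = "add_char (p * q)"
  have "gauss_sum f' (p * q) k = (\<Sum>a\<in>{0..<int (p * q)}. f a * ?e (a * k)) -
     (\<Sum>a\<in>{0..<int (p * q)}. if int p dvd a then f a * ?e (a * k) else 0)"
    unfolding gauss_sum_def sum_subtractf[symmetric] by (rule sum.cong) (auto simp: f'_def)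
  also have "(\<Sum>a\<in>{0..<int (p * q)}. if int p dvd a then f a * ?e (a * k) else 0)
     = (\<Sum>a\<in>{a\<in>{0..<int (p * q)}. int p dvd a}. f a * ?e (a * k))"
    by (rule sum.inter_filter[symmetric]) simp
  also have "\<dots> = (\<Sum>b\<in>{0..<int q}. f (int p * b) * ?e ((int p * b) * k))"
  proof (rule sum.reindex_bij_witness[of _ "\<lambda>b. int p * b" "\<lambda>a. a div int p"])
    fix a assume "a \<in> {a\<in>{0..<int (p * q)}. int p dvd a}"
    then obtain c where "a = int p * c" "0 \<le> int p * c" "int p * c < int p * int q" by auto
    thus "a div int p \<in> {0..<int q}" using p0
      by (simp add: zero_le_mult_iff mult_less_cancel_left_pos)
  qed (use p0 in auto)
  also have "\<dots> = f (int p) * gauss_sum f q k"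
    unfolding gauss_sum_def sum_distrib_left
    by (rule sum.cong)
       (simp_all only: dirichlet_characterD(2)[OF f(1)] mult.assoc add_char_cancel[OF p0])
  also have "(\<Sum>a\<in>{0..<int (p * q)}. f a * ?e (a * k)) =
     (\<Sum>b\<in>{0..<int q}. \<Sum>j\<in>{0..<int p}. f (b + int q * j) * ?e ((b + int q * j) * k))"
    by (rule sum_residue_decompose[OF p0 f(2)])
  also have "\<dots> = (\<Sum>b\<in>{0..<int q}. f b * ?e (b * k) * (\<Sum>j\<in>{0..<int p}. add_char p (j * k)))"
    unfolding sum_distrib_left
  proof (intro sum.cong refl)
    fix b j
    have "f (b + int q * j) = f b" by (rule dirichlet_character_cong[OF f(1)]) (simp add: cong_def)
    moreover have "?e ((b + int q * j) * k) = ?e (b * k) * add_char p (j * k)"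
      using add_char_cancel[OF f(2), of p "j * k"] by (simp only: distrib_right add_char_add mult.commute[of p q] mult.assoc)
    ultimately show "f (b + int q * j) * ?e ((b + int q * j) * k) = f b * ?e (b * k) * add_char p (j * k)"
      by (simp only: mult.assoc)
  qed
  also have "\<dots> = (if int p dvd k then of_nat p * (f (int p) * gauss_sum f q k) else 0)"
  proof (cases "int p dvd k")
    case True
    then obtain l where l: "k = int p * l" by auto
    have "(\<Sum>b\<in>{0..<int q}. f b * ?e (b * k) * (\<Sum>j\<in>{0..<int p}. add_char p (j * k))) =
       (\<Sum>b\<in>{0..<int q}. of_nat p * (f b * add_char q (b * l)))"
    proof (rule sum.cong[OF refl])
      fix b
      have "?e (b * k) = add_char q (b * l)"
        using add_char_cancel[OF p0, of q "b * l"] by (simp only: l mult.left_commute)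
      thus "f b * ?e (b * k) * (\<Sum>j\<in>{0..<int p}. add_char p (j * k)) = of_nat p * (f b * add_char q (b * l))"
        using True by (simp add: sum_add_char[OF p0])
    qed
    also have "\<dots> = of_nat p * gauss_sum f q l" by (simp only: gauss_sum_def sum_distrib_left)
    also have "gauss_sum f q l = f (int p) * gauss_sum f q k"
      unfolding l by (rule gauss_sum_mult[OF f cop, symmetric])
    finally show ?thesis using True by simp
  next
    case False
    thus ?thesis by (simp only: sum_add_char[OF p0] if_False mult_zero_right sum.neutral_const)
  qed
  finally show ?thesis by (cases "int p dvd k") (simp_all add: left_diff_distrib)
qed

text \<open>For a finite set \<open>P\<close> of primes this is \<open>f\<close> times the principal
  character modulo the product of \<open>P\<close>.\<close>

definition sieve_char :: "nat set \<Rightarrow> (int \<Rightarrow> complex) \<Rightarrow> int \<Rightarrow> complex" where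
  "sieve_char P f a = (if \<exists>p\<in>P. int p dvd a then 0 else f a)"

lemma dirichlet_character_remove_prime:
  assumes f: "dirichlet_character q f" "q > 0" and p: "prime p" "\<not> p dvd q"
  shows "dirichlet_character (p * q) (\<lambda>a. if int p dvd a then 0 else f a)"
  unfolding dirichlet_character_def
proof (intro conjI allI)
  have ip: "prime (int p)" using p by simp
  fix a b
  have "f (a + int (p * q)) = f a"
    by (rule dirichlet_character_cong[OF f(1)]) (simp add: cong_def)
  thus "(if int p dvd a + int (p * q) then 0 else f (a + int (p * q))) = (if int p dvd a then 0 else f a)"
    by (simp add: dvd_add_left_iff)
  show "(if int p dvd a * b then 0 else f (a * b)) =
      (if int p dvd a then 0 else f a) * (if int p dvd b then 0 else f b)"
    by (simp add: prime_dvd_mult_iff[OF ip] dirichlet_characterD(2)[OF f(1)])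
  have "coprime a (int p) \<longleftrightarrow> \<not> int p dvd a"
    using ip by (metis coprime_commute coprime_common_divisor dvd_refl not_prime_unit prime_imp_coprime)
  thus "(if int p dvd a then 0 else f a) \<noteq> 0 \<longleftrightarrow> coprime a (int (p * q))"
    by (simp add: dirichlet_characterD(3)[OF f(1)])
qed

text \<open>The primes are removed one at a time. Both claims are proved in one induction, because
  removing the next prime requires that the previous stage is a character.\<close>

lemma sieve_char:
  assumes f: "dirichlet_character d f" "d > 0" and P: "finite P" "\<And>p. p \<in> P \<Longrightarrow> prime p \<and> \<not> p dvd d"
  shows "dirichlet_character (d * \<Prod>P) (sieve_char P f)"
    and "cmod (gauss_sum (sieve_char P f) (d * \<Prod>P) (int k)) =
           cmod (gauss_sum f d (int k)) * sieve_weight P k"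
proof -
  have "dirichlet_character (d * \<Prod>P) (sieve_char P f) \<and>
     (\<forall>k. cmod (gauss_sum (sieve_char P f) (d * \<Prod>P) (int k)) = cmod (gauss_sum f d (int k)) * sieve_weight P k)"
    using P
  proof (induction P rule: finite_induct)
    case empty
    have "sieve_char {} f = f" by (simp add: sieve_char_def fun_eq_iff)
    thus ?case using f by (simp add: sieve_weight_def)
  next
    case (insert p P)
    define Q where "Q = d * \<Prod>P"
    have P: "prime r" "\<not> r dvd d" if "r \<in> insert p P" for r using insert.prems[OF that] by auto
    have Q: "Q > 0" using f P insert.hyps by (auto simp: Q_def intro!: prod_pos prime_gt_0_nat)
    have p: "prime p" using P by simp
    have pQ: "\<not> p dvd Q"
    proof
      assume "p dvd Q"
      hence "p dvd \<Prod>P" using P p by (auto simp: Q_def prime_dvd_mult_iff)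
      then obtain r where "r \<in> P" "p dvd r" using p insert.hyps by (auto simp: prime_dvd_prod_iff)
      thus False using P p insert.hyps by (metis insert_iff primes_dvd_imp_eq)
    qed
    have eq: "sieve_char (insert p P) f = (\<lambda>a. if int p dvd a then 0 else sieve_char P f a)"
      by (auto simp: sieve_char_def fun_eq_iff)
    have IH: "dirichlet_character Q (sieve_char P f)"
      "\<And>k. cmod (gauss_sum (sieve_char P f) Q (int k)) = cmod (gauss_sum f d (int k)) * sieve_weight P k"
      using insert.IH P unfolding Q_def by blast+
    have pq: "d * \<Prod>(insert p P) = p * Q" using insert.hyps by (simp add: Q_def mult_ac)
    have "coprime (int p) (int Q)" using p pQ by (simp add: prime_imp_coprime)
    hence fp: "cmod (sieve_char P f (int p)) = 1" using dirichlet_character_norm[OF IH(1) Q] by simp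
    have "cmod (of_nat p - 1) = real p - 1"
      using prime_gt_1_nat[OF p] norm_of_nat[of "p - 1", where ?'a = complex] by (simp add: of_nat_diff)
    hence "cmod (gauss_sum (sieve_char (insert p P) f) (p * Q) (int k)) =
        cmod (gauss_sum f d (int k)) * sieve_weight (insert p P) k" for k
      unfolding eq gauss_sum_remove_prime[OF IH(1) Q p pQ] norm_mult fp IH(2)
      using insert.hyps by (simp add: sieve_weight_def)
    thus ?case unfolding pq using dirichlet_character_remove_prime[OF IH(1) Q p pQ] by (simp add: eq)
  qed
  thus "dirichlet_character (d * \<Prod>P) (sieve_char P f)"
     "cmod (gauss_sum (sieve_char P f) (d * \<Prod>P) (int k)) = cmod (gauss_sum f d (int k)) * sieve_weight P k"
    by blast+
qed

section \<open>Completion of incomplete sums\<close>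

text \<open>A geometric series with ratio \<open>z\<close>, where |1 - z^m| = 2 |sin(pi k m /
  q)|.\<close>

lemma norm_sum_add_char_le:
  assumes "0 < k" "k < q"
  shows "cmod (\<Sum>m\<in>{1..X::nat}. add_char q (- (int k * int m)))
           \<le> \<bar>sin (pi * real k * real X / real q)\<bar> / sin (pi * real k / real q)"
proof -
  define z where "z = add_char q (- int k)"
  have pw: "add_char q (- (int k * int m)) = z ^ m" for m
  proof (induction m)
    case (Suc m)
    have "- (int k * int (Suc m)) = - int k + - (int k * int m)" by (simp add: algebra_simps)
    thus ?case using Suc by (simp only: add_char_add z_def power_Suc)
  qed simp
  have nrm: "cmod (1 - z ^ m) = 2 * \<bar>sin (pi * real k * real m / real q)\<bar>" for m
  proof -
    have "z ^ m = exp (\<i> * of_real (- (2 * pi * real k * real m / real q)))"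
      unfolding pw[symmetric] add_char_def cis_conv_exp by (simp add: algebra_simps)
    hence "cmod (1 - z ^ m) = 2 * \<bar>sin (- (2 * pi * real k * real m / real q) / 2)\<bar>"
      by (metis dist_exp_i_1 norm_minus_commute)
    thus ?thesis by (simp add: mult.assoc)
  qed
  have s: "sin (pi * real k / real q) > 0"
    using assms by (intro sin_gt_zero) (simp_all add: field_simps)
  have "(1 - z) * (\<Sum>m\<in>{1..X}. z ^ m) = z * (1 - z ^ X)"
  proof (induction X)
    case (Suc X)
    have "(1 - z) * (\<Sum>m\<in>{1..Suc X}. z ^ m) = (1 - z) * (\<Sum>m\<in>{1..X}. z ^ m) + (1 - z) * z ^ Suc X"
      by (simp add: distrib_left)
    also have "\<dots> = z * (1 - z ^ X) + (1 - z) * z ^ Suc X" by (simp only: Suc)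
    also have "\<dots> = z * (1 - z ^ Suc X)" by (simp add: algebra_simps)
    finally show ?case .
  qed simp
  hence "cmod (1 - z) * cmod (\<Sum>m\<in>{1..X}. z ^ m) = cmod z * cmod (1 - z ^ X)"
    by (metis norm_mult)
  hence "sin (pi * real k / real q) * cmod (\<Sum>m\<in>{1..X}. z ^ m) = \<bar>sin (pi * real k * real X / real q)\<bar>"
    using nrm[of 1] nrm[of X] s by (simp add: z_def)
  thus ?thesis unfolding pw using s by (simp add: pos_le_divide_eq mult.commute)
qed

text \<open>Each value of \<open>f\<close> is expanded by Fourier inversion. The frequency 0, whose
  kernel would be of size X, drops out by the assumption on the Gauss sum.\<close>

lemma completing_bound:
  assumes "q > 0" "\<And>a. f (a + int q) = f a" "gauss_sum f q 0 = 0"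
  shows "real q * cmod (\<Sum>m\<in>{1..X::nat}. f (int m)) \<le>
     (\<Sum>k\<in>{1..<q}. cmod (gauss_sum f q (int k)) *
        (\<bar>sin (pi * real k * real X / real q)\<bar> / sin (pi * real k / real q)))"
proof -
  have im: "{1..<int q} = int ` {1..<q}"
    by (simp add: image_int_atLeastLessThan)
  have "of_nat q * (\<Sum>m\<in>{1..X}. f (int m)) =
     (\<Sum>m\<in>{1..X}. \<Sum>k\<in>{0..<int q}. gauss_sum f q k * add_char q (- (k * int m)))"
    by (simp only: sum_distrib_left gauss_sum_inversion[of q f, OF assms(1,2)])
  also have "\<dots> = (\<Sum>k\<in>{0..<int q}. gauss_sum f q k * (\<Sum>m\<in>{1..X}. add_char q (- (k * int m))))"
    by (subst sum.swap) (simp only: sum_distrib_left)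
  also have "\<dots> = (\<Sum>k\<in>{1..<int q}. gauss_sum f q k * (\<Sum>m\<in>{1..X}. add_char q (- (k * int m))))"
  proof (rule sum.mono_neutral_right)
    show "\<forall>k\<in>{0..<int q} - {1..<int q}. gauss_sum f q k * (\<Sum>m\<in>{1..X}. add_char q (- (k * int m))) = 0"
    proof
      fix k assume "k \<in> {0..<int q} - {1..<int q}"
      hence "k = 0" by auto
      thus "gauss_sum f q k * (\<Sum>m\<in>{1..X}. add_char q (- (k * int m))) = 0" using assms(3) by simp
    qed
  qed auto
  also have "\<dots> = (\<Sum>k\<in>{1..<q}. gauss_sum f q (int k) * (\<Sum>m\<in>{1..X}. add_char q (- (int k * int m))))"
    unfolding im by (subst sum.reindex) auto
  finally have *: "of_nat q * (\<Sum>m\<in>{1..X}. f (int m)) = \<dots>" .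
  have "real q * cmod (\<Sum>m\<in>{1..X}. f (int m)) = cmod (of_nat q * (\<Sum>m\<in>{1..X}. f (int m)))"
    by (simp add: norm_mult)
  also have "\<dots> \<le> (\<Sum>k\<in>{1..<q}. cmod (gauss_sum f q (int k)) *
        (\<bar>sin (pi * real k * real X / real q)\<bar> / sin (pi * real k / real q)))"
    unfolding *
  proof (rule sum_norm_le)
    fix k assume "k \<in> {1..<q}"
    thus "cmod (gauss_sum f q (int k) * (\<Sum>m\<in>{1..X}. add_char q (- (int k * int m)))) \<le>
        cmod (gauss_sum f q (int k)) * (\<bar>sin (pi * real k * real X / real q)\<bar> / sin (pi * real k / real q))"
      unfolding norm_mult by (intro mult_left_mono norm_sum_add_char_le) auto
  qed
  finally show ?thesis .
qed

text \<open>Reflecting k to q - k folds the sum onto k \<le> q / 2, where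
  \<open>inverse_sin_le\<close> applies with y = pi k / q. Its term 1 / y gives the sum with weights
  1 / k. Its term 1 / 2, with the sine in the numerator bounded by 1, gives half the total
  weight.\<close>

lemma sum_symmetric_kernel_le:
  fixes W :: "nat \<Rightarrow> real"
  assumes "q > 0" "\<And>k. W k \<ge> 0" "\<And>k. 0 < k \<Longrightarrow> k < q \<Longrightarrow> W (q - k) = W k"
  shows "(\<Sum>k\<in>{1..<q}. W k * (\<bar>sin (pi * real k * real X / real q)\<bar> / sin (pi * real k / real q)))
     \<le> 2 * real q / pi * (\<Sum>k\<in>{k. 1 \<le> k \<and> real k \<le> real q / 2}. W k * \<bar>sin (real k * (pi * real X / real q))\<bar> / real k)
        + (\<Sum>k\<in>{1..<q}. W k) / 2"
proof -
  define T where "T = (\<lambda>k. W k * (\<bar>sin (pi * real k * real X / real q)\<bar> / sin (pi * real k / real q)))"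
  define V where "V = (\<lambda>k. W k * \<bar>sin (real k * (pi * real X / real q))\<bar> / real k)"
  have V0: "V k \<ge> 0" for k using assms by (simp add: V_def)
  have T_sym: "T (q - k) = T k" if "0 < k" "k < q" for k
  proof -
    have 1: "pi * real (q - k) / real q = pi - pi * real k / real q"
      using that by (simp add: of_nat_diff field_simps)
    have 2: "pi * real (q - k) * real X / real q = real X * pi - pi * real k * real X / real q"
      using that by (simp add: of_nat_diff field_simps)
    have "\<bar>sin (real X * pi - pi * real k * real X / real q)\<bar> = \<bar>sin (pi * real k * real X / real q)\<bar>"
      by (simp add: sin_diff abs_mult cos_npi)
    thus ?thesis using that assms(3) unfolding T_def 1 2 by simp
  qed
  have T_le: "T k \<le> real q / pi * V k + W k / 2" if "0 < k" "real k \<le> real q / 2" for k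
  proof -
    have y: "0 < pi * real k / real q" "pi * real k / real q \<le> pi / 2"
      using that assms(1) by (simp_all add: field_simps)
    have "T k = W k * (\<bar>sin (pi * real k * real X / real q)\<bar> * (1 / sin (pi * real k / real q)))"
      unfolding T_def by simp
    also have "\<dots> \<le> W k * (\<bar>sin (pi * real k * real X / real q)\<bar> * (1 / (pi * real k / real q) + 1 / 2))"
      by (intro mult_left_mono inverse_sin_le y assms(2) abs_ge_zero)
    also have "\<dots> = real q / pi * V k + W k * \<bar>sin (pi * real k * real X / real q)\<bar> / 2"
      using that assms(1) by (simp add: V_def field_simps)
    also have "\<dots> \<le> real q / pi * V k + W k * 1 / 2"
      using assms(2)[of k] by (intro add_left_mono divide_right_mono mult_left_mono) auto
    finally show ?thesis by simp
  qed
  have "(\<Sum>k\<in>{1..<q}. if real k \<le> real q / 2 then V k else V (q - k)) =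
     (\<Sum>k\<in>{k\<in>{1..<q}. real k \<le> real q / 2}. V k) + (\<Sum>k\<in>{k\<in>{1..<q}. \<not> real k \<le> real q / 2}. V (q - k))"
    unfolding sum.If_cases[OF finite_atLeastLessThan] by (simp only: Int_def Compl_iff mem_Collect_eq)
  also have "(\<Sum>k\<in>{k\<in>{1..<q}. \<not> real k \<le> real q / 2}. V (q - k)) = (\<Sum>k\<in>{k. 1 \<le> k \<and> real k < real q / 2}. V k)"
    by (rule sum.reindex_bij_witness[of _ "\<lambda>k. q - k" "\<lambda>k. q - k"]) (auto simp: of_nat_diff)
  \<comment> \<open>The reflected range stops strictly below q / 2. Enlarging it counts a frequency
    equal to q / 2 twice, which only weakens the bound.\<close>
  also have "\<dots> \<le> (\<Sum>k\<in>{k. 1 \<le> k \<and> real k \<le> real q / 2}. V k)"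
    by (rule sum_mono2) (use V0 in \<open>auto intro: finite_subset[of _ "{1..q}"]\<close>)
  also have "(\<Sum>k\<in>{k\<in>{1..<q}. real k \<le> real q / 2}. V k) = (\<Sum>k\<in>{k. 1 \<le> k \<and> real k \<le> real q / 2}. V k)"
    by (rule sum.cong) auto
  finally have M: "(\<Sum>k\<in>{1..<q}. if real k \<le> real q / 2 then V k else V (q - k)) \<le>
      2 * (\<Sum>k\<in>{k. 1 \<le> k \<and> real k \<le> real q / 2}. V k)" by simp
  have "(\<Sum>k\<in>{1..<q}. T k) \<le> (\<Sum>k\<in>{1..<q}. real q / pi * (if real k \<le> real q / 2 then V k else V (q - k)) + W k / 2)"
  proof (rule sum_mono)
    fix k assume k: "k \<in> {1..<q}"
    show "T k \<le> real q / pi * (if real k \<le> real q / 2 then V k else V (q - k)) + W k / 2"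
    proof (cases "real k \<le> real q / 2")
      case True
      thus ?thesis using T_le[of k] k by simp
    next
      case False
      hence "T (q - k) \<le> real q / pi * V (q - k) + W (q - k) / 2"
        using k by (intro T_le) (auto simp: of_nat_diff)
      thus ?thesis using False k T_sym[of k] assms(3)[of k] by simp
    qed
  qed
  also have "\<dots> = real q / pi * (\<Sum>k\<in>{1..<q}. if real k \<le> real q / 2 then V k else V (q - k)) + (\<Sum>k\<in>{1..<q}. W k) / 2"
    by (simp add: sum.distrib sum_distrib_left sum_divide_distrib)
  also have "\<dots> \<le> real q / pi * (2 * (\<Sum>k\<in>{k. 1 \<le> k \<and> real k \<le> real q / 2}. V k)) + (\<Sum>k\<in>{1..<q}. W k) / 2"
    by (intro add_right_mono mult_left_mono M) simp
  finally show ?thesis unfolding T_def V_def by simp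
qed

section \<open>Pairing frequencies with their doubles\<close>

lemma cop_upto_mono: "Y \<le> Z \<Longrightarrow> cop_upto R Y \<subseteq> cop_upto R Z"
  by (auto simp: cop_upto_def)

text \<open>Bounding every sine by 1 would give the constant 2 = 1 + 1/2 + 1/4 + ... in place of
  \<open>sqrt 3\<close>. The angle is arbitrary in the induction because it is multiplied by 4 along
  the way.\<close>

lemma sum_abs_sin_le:
  fixes w :: "nat \<Rightarrow> real"
  assumes R: "\<And>r. r \<in> R \<Longrightarrow> prime r" "2 \<notin> R" and w: "\<And>k. w k \<ge> 0" "\<And>k. w (2 * k) = w k"
  shows "(\<Sum>k\<in>cop_upto R Y. w k * \<bar>sin (real k * \<theta>)\<bar> / real k) \<le>
           sqrt 3 * (\<Sum>k\<in>cop_upto (insert 2 R) Y. w k / real k)"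
proof (induction "nat \<lfloor>Y\<rfloor>" arbitrary: Y \<theta> rule: less_induct)
  case less
  define U where "U = (\<lambda>Y \<theta>. \<Sum>k\<in>cop_upto R Y. w k * \<bar>sin (real k * \<theta>)\<bar> / real k)"
  define V where "V = (\<lambda>Y \<theta>. \<Sum>k\<in>cop_upto (insert 2 R) Y. w k * \<bar>sin (real k * \<theta>)\<bar> / real k)"
  define B where "B = (\<lambda>Y. \<Sum>k\<in>cop_upto (insert 2 R) Y. w k / real k)"
  show ?case
  proof (cases "Y < 1")
    case True
    hence "cop_upto R Y = {}" "cop_upto (insert 2 R) Y = {}" by (auto simp: cop_upto_def)
    thus ?thesis by simp
  next
    case False
    text \<open>Two splittings by parity pair each odd \<open>m\<close> with \<open>2 * m\<close> and leave the multiples of 4,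
      with the angle \<open>4 * \<theta>\<close>, to the induction hypothesis.\<close>
    have split: "U Y \<theta> = V Y \<theta> + U (Y / 2) (2 * \<theta>) / 2" for Y \<theta>
    proof -
      have "U Y \<theta> = V Y \<theta> + (\<Sum>k\<in>cop_upto R (Y / real 2). w (2 * k) * \<bar>sin (real (2 * k) * \<theta>)\<bar> / real (2 * k))"
        unfolding U_def V_def by (rule sum_cop_upto_split) (use R in auto)
      also have "(\<Sum>k\<in>cop_upto R (Y / real 2). w (2 * k) * \<bar>sin (real (2 * k) * \<theta>)\<bar> / real (2 * k)) = U (Y / 2) (2 * \<theta>) / 2"
        unfolding U_def w(2) sum_divide_distrib by (rule sum.cong) (simp_all add: mult_ac)
      finally show ?thesis .
    qed
    have lt: "nat \<lfloor>Y / 2 / 2\<rfloor> < nat \<lfloor>Y\<rfloor>"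
    proof -
      have "1 \<le> \<lfloor>Y\<rfloor>" using False by simp
      hence "Y / 2 / 2 < real_of_int \<lfloor>Y\<rfloor>" using floor_correct[of Y] by linarith
      hence "\<lfloor>Y / 2 / 2\<rfloor> < \<lfloor>Y\<rfloor>" by (simp add: floor_less_iff)
      thus ?thesis using False by simp
    qed
    have sub: "cop_upto (insert 2 R) (Y / 2) \<subseteq> cop_upto (insert 2 R) Y"
      "cop_upto (insert 2 R) (Y / 2 / 2) \<subseteq> cop_upto (insert 2 R) Y"
      by (rule cop_upto_mono, use False in simp)+
    have 1: "U Y \<theta> = V Y \<theta> + V (Y / 2) (2 * \<theta>) / 2 + U (Y / 2 / 2) (2 * (2 * \<theta>)) / 4"
      using split[of Y \<theta>] split[of "Y / 2" "2 * \<theta>"] by simp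
    \<comment> \<open>Raising the cutoff from \<open>Y / 2\<close> to \<open>Y\<close> gives every
      odd frequency its double as a partner.\<close>
    have 2: "V (Y / 2) (2 * \<theta>) \<le> V Y (2 * \<theta>)"
      unfolding V_def by (rule sum_mono2[OF finite_cop_upto sub(1)]) (simp add: w(1))
    have "V Y \<theta> + V Y (2 * \<theta>) / 2 =
        (\<Sum>k\<in>cop_upto (insert 2 R) Y. w k / real k * (\<bar>sin (real k * \<theta>)\<bar> + \<bar>sin (2 * (real k * \<theta>))\<bar> / 2))"
      unfolding V_def sum_divide_distrib sum.distrib[symmetric]
      by (rule sum.cong) (simp_all add: distrib_left mult.left_commute)
    also have "\<dots> \<le> (\<Sum>k\<in>cop_upto (insert 2 R) Y. w k / real k * (3 * sqrt 3 / 4))"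
      by (intro sum_mono mult_left_mono sin_plus_half_sin_double_le) (simp add: w(1))
    also have "\<dots> = 3 * sqrt 3 / 4 * B Y"
      unfolding B_def sum_distrib_left by (simp add: mult.commute)
    finally have 3: "V Y \<theta> + V Y (2 * \<theta>) / 2 \<le> 3 * sqrt 3 / 4 * B Y" .
    have "U (Y / 2 / 2) (2 * (2 * \<theta>)) \<le> sqrt 3 * B (Y / 2 / 2)"
      unfolding U_def B_def by (rule less) (rule lt)
    also have "\<dots> \<le> sqrt 3 * B Y"
      unfolding B_def by (intro mult_left_mono sum_mono2[OF finite_cop_upto sub(2)]) (simp_all add: w(1))
    \<comment> \<open>The constant \<open>sqrt 3\<close> solves C = 3 * sqrt 3 / 4 + C / 4.\<close>
    finally have "U Y \<theta> \<le> sqrt 3 * B Y" using 1 2 3 by linarith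
    thus ?thesis unfolding U_def B_def .
  qed
qed

section \<open>Total weight of the frequencies coprime to d\<close>

lemma coprime_iff_prime_factors:
  fixes k d :: nat
  assumes "d > 0"
  shows "coprime k d \<longleftrightarrow> (\<forall>p\<in>prime_factors d. \<not> p dvd k)"
proof
  assume "coprime k d"
  thus "\<forall>p\<in>prime_factors d. \<not> p dvd k"
    by (metis coprime_common_divisor in_prime_factors_iff not_prime_unit)
next
  assume *: "\<forall>p\<in>prime_factors d. \<not> p dvd k"
  show "coprime k d"
  proof (rule ccontr)
    assume "\<not> coprime k d"
    then obtain p where "prime p" "p dvd k" "p dvd d"
      by (metis coprime_iff_gcd_eq_1 gcd_dvd1 gcd_dvd2 dvd_trans prime_factor_nat)
    thus False using * assms by (auto simp: prime_factors_dvd)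
  qed
qed

lemma card_coprime_multiple_interval:
  "card {k\<in>{1..d * m}. coprime k d} = m * totient d"
proof (induction m)
  case (Suc m)
  have gcd: "gcd (j + d * m) d = gcd j d" for j
    by (metis gcd_add_mult gcd.commute add.commute mult.commute)
  have "{k\<in>{1..d * Suc m}. coprime k d} = {k\<in>{1..d * m}. coprime k d} \<union> (\<lambda>k. k + d * m) ` {k\<in>{1..d}. coprime k d}"
  proof (intro equalityI subsetI)
    fix k assume k: "k \<in> {k\<in>{1..d * Suc m}. coprime k d}"
    show "k \<in> {k\<in>{1..d * m}. coprime k d} \<union> (\<lambda>k. k + d * m) ` {k\<in>{1..d}. coprime k d}"
    proof (cases "k \<le> d * m")
      case False
      then obtain j where j: "k = j + d * m" "j \<ge> 1" by (metis add.commute le_add_diff_inverse nat_le_linear not_less_eq_eq One_nat_def add_cancel_right_left not0_implies_Suc Suc_le_mono le0)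
      have "coprime j d" using k j gcd by (simp add: coprime_iff_gcd_eq_1)
      thus ?thesis using j k by auto
    qed (use k in auto)
  next
    fix k assume "k \<in> {k\<in>{1..d * m}. coprime k d} \<union> (\<lambda>k. k + d * m) ` {k\<in>{1..d}. coprime k d}"
    thus "k \<in> {k\<in>{1..d * Suc m}. coprime k d}" by (auto simp: coprime_iff_gcd_eq_1 gcd)
  qed
  moreover have "card ({k\<in>{1..d * m}. coprime k d} \<union> (\<lambda>k. k + d * m) ` {k\<in>{1..d}. coprime k d})
      = card {k\<in>{1..d * m}. coprime k d} + card ((\<lambda>k. k + d * m) ` {k\<in>{1..d}. coprime k d})"
    by (rule card_Un_disjoint) auto
  moreover have "card ((\<lambda>k. k + d * m) ` {k\<in>{1..d}. coprime k d}) = totient d"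
    by (subst card_image) (use card_coprime_interval[of d] in auto)
  ultimately show ?case using Suc by simp
qed simp

text \<open>The number \<open>m\<close> of periods is free for the sake of the induction: when
  \<open>p\<close> is adjoined, the sum of the old weights runs over m p old periods, and the
  multiples of \<open>p\<close>, divided by \<open>p\<close>, run over m of them. Then p + (p - 2) =
  2 (p - 1).\<close>

lemma sum_sieve_weight_coprime:
  assumes d: "d > 0" and P: "finite P" "\<And>p. p \<in> P \<Longrightarrow> prime p \<and> \<not> p dvd d"
  shows "(\<Sum>k\<in>cop_upto (prime_factors d) (real (d * m * \<Prod>P)). sieve_weight P k) =
           real m * real (totient d) * (\<Prod>p\<in>P. 2 * (real p - 1))"
  using P
proof (induction P arbitrary: m rule: finite_induct)
  case empty
  have "cop_upto (prime_factors d) (real (d * m)) = {k\<in>{1..d * m}. coprime k d}"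
    by (auto simp: cop_upto_def coprime_iff_prime_factors[OF d] simp del: of_nat_mult)
  moreover have "real (card {k\<in>{1..d * m}. coprime k d}) = real m * real (totient d)"
    by (simp only: card_coprime_multiple_interval of_nat_mult)
  ultimately show ?case by (simp add: sieve_weight_def)
next
  case (insert p P)
  let ?R = "prime_factors d"
  have p: "prime p" "p > 0" "p \<notin> ?R" using insert.prems[of p] by (auto simp: prime_gt_0_nat)
  have IH: "(\<Sum>k\<in>cop_upto ?R (real (d * m * \<Prod>P)). sieve_weight P k) =
           real m * real (totient d) * (\<Prod>p\<in>P. 2 * (real p - 1))" for m
    using insert by blast
  have w: "sieve_weight (insert p P) k = sieve_weight P k + (if p dvd k then (real p - 2) * sieve_weight P k else 0)" for k
    using insert.hyps by (simp add: sieve_weight_def algebra_simps)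
  define Y where "Y = real (d * m * \<Prod>(insert p P))"
  have Y: "Y = real (d * (m * p) * \<Prod>P)" "Y / real p = real (d * m * \<Prod>P)"
    using insert.hyps p by (simp_all add: Y_def mult_ac)
  have s1: "(\<Sum>k\<in>cop_upto ?R Y. sieve_weight P k) = real (m * p) * real (totient d) * (\<Prod>p\<in>P. 2 * (real p - 1))"
    by (simp only: Y(1) IH)
  have s2: "(\<Sum>k\<in>cop_upto ?R (Y / real p). sieve_weight P k) = real m * real (totient d) * (\<Prod>p\<in>P. 2 * (real p - 1))"
    by (simp only: Y(2) IH)
  have "(\<Sum>k\<in>cop_upto ?R Y. sieve_weight (insert p P) k) =
     (\<Sum>k\<in>cop_upto ?R Y. sieve_weight P k) + (\<Sum>k\<in>{k\<in>cop_upto ?R Y. p dvd k}. (real p - 2) * sieve_weight P k)"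
    unfolding w sum.distrib sum.inter_filter[OF finite_cop_upto] ..
  also have "(\<Sum>k\<in>{k\<in>cop_upto ?R Y. p dvd k}. (real p - 2) * sieve_weight P k) =
      (\<Sum>k\<in>cop_upto ?R (Y / real p). (real p - 2) * sieve_weight P (p * k))"
    by (rule sum_cop_upto_multiples)
       (use p prime_dvd_mult_prime_iff in_prime_factors_imp_prime in blast)+
  also have "\<dots> = (real p - 2) * (\<Sum>k\<in>cop_upto ?R (Y / real p). sieve_weight P k)"
    unfolding sum_distrib_left
    by (rule sum.cong) (use insert p in \<open>auto simp: sieve_weight_mult\<close>)
  also have "(\<Sum>k\<in>cop_upto ?R Y. sieve_weight P k) + \<dots> =
     real m * real (totient d) * (2 * (real p - 1)) * (\<Prod>p\<in>P. 2 * (real p - 1))"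
    unfolding s1 s2 by (simp add: algebra_simps)
  finally show ?case using insert.hyps by (simp add: Y_def)
qed

section \<open>Numerical estimates\<close>

text \<open>Primes from 5 on contribute factors below 1, so only 2 and 3 can enlarge the product.
  The constants are rounded up from 4 / sqrt 6 and 2 / sqrt 3.\<close>

lemma prod_two_over_sqrt_le:
  assumes "finite P" "\<And>p. p \<in> P \<Longrightarrow> prime p"
  shows "(\<Prod>p\<in>P. 2 / sqrt (real p)) \<le> 1.634"
    and "2 \<notin> P \<Longrightarrow> (\<Prod>p\<in>P. 2 / sqrt (real p)) \<le> 1.1548"
proof -
  have "(\<Prod>p\<in>P. 2 / sqrt (real p)) = (\<Prod>p\<in>P \<inter> {2,3}. 2 / sqrt (real p)) * (\<Prod>p\<in>P - {2,3}. 2 / sqrt (real p))"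
    by (subst prod.union_disjoint[symmetric]) (use assms(1) in \<open>auto intro!: prod.cong\<close>)
  also have "\<dots> \<le> (\<Prod>p\<in>P \<inter> {2,3}. 2 / sqrt (real p)) * 1"
  proof (intro mult_left_mono prod_le_1 conjI prod_nonneg ballI)
    fix p assume p: "p \<in> P - {2,3}"
    hence "prime p" "p \<noteq> 2" "p \<noteq> 3" using assms(2) by auto
    hence "p \<ge> 4" using prime_ge_2_nat[of p] by linarith
    hence "sqrt 4 \<le> sqrt (real p)" by (intro real_sqrt_le_mono) simp
    thus "2 / sqrt (real p) \<le> 1" by (simp add: divide_le_eq)
  qed auto
  finally have *: "(\<Prod>p\<in>P. 2 / sqrt (real p)) \<le> (\<Prod>p\<in>P \<inter> {2,3}. 2 / sqrt (real p))" by simp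
  have "1.41417 \<le> sqrt (2::real)" "1.732 \<le> sqrt (3::real)"
    by (rule real_le_rsqrt, simp add: power2_eq_square)+
  hence s: "2 / sqrt (2::real) \<le> 1.4143" "2 / sqrt (3::real) \<le> 1.1548" by (simp_all add: field_simps)
  have s': "2 / sqrt (2::real) * (2 / sqrt 3) \<le> 1.4143 * 1.1548"
    by (intro mult_mono s) auto
  consider "P \<inter> {2,3} = {}" | "P \<inter> {2,3} = {2}" | "P \<inter> {2,3} = {3}" | "P \<inter> {2,3} = {2,3}"
    by blast
  thus "(\<Prod>p\<in>P. 2 / sqrt (real p)) \<le> 1.634"
    by cases (use * s s' in auto)
  assume "2 \<notin> P"
  hence "P \<inter> {2,3} = {} \<or> P \<inter> {2,3} = {3}" by blast
  thus "(\<Prod>p\<in>P. 2 / sqrt (real p)) \<le> 1.1548"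
    using * s by auto
qed

text \<open>Split 1 / (p - 1) into c and the excess over c. The first part sums to c times the
  logarithm of the product of \<open>R\<close>; the excess is not positive outside
  \<open>S\<close>.\<close>

lemma sum_log_over_prime_le:
  assumes "finite R" "\<And>p. p \<in> R \<Longrightarrow> prime p" "finite S" 
    and S: "\<And>p. p \<in> S \<Longrightarrow> p \<ge> 1 \<and> c \<le> 1 / (real p - 1)"
    and RS: "\<And>p. p \<in> R - S \<Longrightarrow> 1 / (real p - 1) \<le> c"
  shows "(\<Sum>p\<in>R. ln (real p) / (real p - 1)) \<le>
           (\<Sum>p\<in>S. (1 / (real p - 1) - c) * ln (real p)) + c * ln (real (\<Prod>R))"
proof -
  have R1: "real p \<ge> 1" if "p \<in> R" for p using prime_ge_1_nat[OF assms(2)[OF that]] by simp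
  have "(\<Sum>p\<in>R. ln (real p) / (real p - 1)) =
      (\<Sum>p\<in>R. (1 / (real p - 1) - c) * ln (real p)) + c * (\<Sum>p\<in>R. ln (real p))"
    unfolding sum_distrib_left sum.distrib[symmetric] by (rule sum.cong) (simp_all add: algebra_simps)
  also have "(\<Sum>p\<in>R. ln (real p)) = ln (real (\<Prod>R))"
    unfolding of_nat_prod by (rule ln_prod[symmetric]) (use assms(1) R1 in force)+
  also have "(\<Sum>p\<in>R. (1 / (real p - 1) - c) * ln (real p)) \<le> (\<Sum>p\<in>R \<inter> S. (1 / (real p - 1) - c) * ln (real p))"
  proof -
    have "(\<Sum>p\<in>R. (1 / (real p - 1) - c) * ln (real p)) =
        (\<Sum>p\<in>R \<inter> S. (1 / (real p - 1) - c) * ln (real p)) + (\<Sum>p\<in>R - S. (1 / (real p - 1) - c) * ln (real p))"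
      by (rule sum.Int_Diff[OF assms(1)])
    moreover have "(\<Sum>p\<in>R - S. (1 / (real p - 1) - c) * ln (real p)) \<le> 0"
      by (rule sum_nonpos) (use R1 RS in \<open>auto intro!: mult_nonpos_nonneg\<close>)
    ultimately show ?thesis by simp
  qed
  also have "\<dots> \<le> (\<Sum>p\<in>S. (1 / (real p - 1) - c) * ln (real p))"
    by (rule sum_mono2) (use assms(3) S in \<open>auto intro!: mult_nonneg_nonneg\<close>)
  finally show ?thesis by simp
qed

lemma prod_prime_factors_dvd: "n > 0 \<Longrightarrow> \<Prod>(prime_factors n) dvd (n::nat)"
proof -
  assume n: "n > 0"
  have "(\<Prod>p\<in>prime_factors n. p) dvd (\<Prod>p\<in>prime_factors n. p ^ multiplicity p n)"
    by (rule prod_dvd_prod) (auto simp: prime_factors_multiplicity intro: dvd_power)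
  thus ?thesis using n prime_factorization_nat[of n] by simp
qed

text \<open>Every odd prime factor contributes p - 1 \<ge> 2 to the totient, while the prime 2
  contributes only 1.\<close>

lemma two_power_omega_le_totient:
  assumes "d > 0"
  shows "2 ^ card (prime_factors d) \<le> 2 * totient d"
    and "odd d \<Longrightarrow> 2 ^ card (prime_factors d) \<le> totient d"
proof -
  let ?R = "prime_factors d"
  have le: "(\<Prod>p\<in>?R. p - 1) \<le> totient d"
    unfolding totient_formula1[OF assms]
    by (rule prod_mono) (auto simp: prime_gt_0_nat dest: in_prime_factors_imp_prime)
  have "(\<Prod>p\<in>?R - {2}. 2) \<le> (\<Prod>p\<in>?R - {2}. p - 1)"
  proof (rule prod_mono)
    fix p assume "p \<in> ?R - {2}"
    hence "prime p" "p \<noteq> 2" by (auto simp: in_prime_factors_imp_prime)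
    thus "0 \<le> (2::nat) \<and> 2 \<le> p - 1" using prime_ge_2_nat[of p] by linarith
  qed
  hence 1: "2 ^ card (?R - {2}) \<le> (\<Prod>p\<in>?R - {2}. p - 1)" by simp
  also have "\<dots> = (\<Prod>p\<in>?R. p - 1)"
    by (rule prod.mono_neutral_left) auto
  finally have 2: "2 ^ card (?R - {2}) \<le> totient d" using le by simp
  have "card ?R \<le> Suc (card (?R - {2}))" by (simp add: card_Diff_singleton_if) arith
  hence "(2::nat) ^ card ?R \<le> 2 ^ Suc (card (?R - {2}))" by (rule power_increasing) simp
  thus "2 ^ card ?R \<le> 2 * totient d" using 2 by simp
  assume "odd d"
  hence "?R - {2} = ?R" by (auto simp: prime_factors_dvd)
  thus "2 ^ card ?R \<le> totient d" using 2 by simp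
qed

text \<open>The last assumption makes the error term at most 4 times the density, so that it joins
  the logarithm as the summand 4.\<close>

lemma cop_harm_le:
  assumes "finite R" "\<And>r. r \<in> R \<Longrightarrow> prime r" "Y > 0" "2 ^ card R \<le> 4 * Y * (\<Prod>p\<in>R. 1 - 1 / real p)"
  shows "cop_harm R Y \<le> (\<Prod>p\<in>R. 1 - 1 / real p) *
            (ln Y + euler_mascheroni + (\<Sum>p\<in>R. ln (real p) / (real p - 1)) + 4)"
proof -
  have "2 ^ card R / Y \<le> 4 * (\<Prod>p\<in>R. 1 - 1 / real p)"
    using assms(3,4) by (simp add: pos_divide_le_eq mult_ac)
  thus ?thesis using cop_harm_bound[OF assms(1-3)] by (simp add: distrib_left)
qed

text \<open>Each bound compares integer powers, such as 3^5 = 243 and 2^8 = 256.\<close>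

lemma ln_small_bounds:
  "ln (3::real) \<le> 8/5 * ln 2" "ln (5::real) \<le> 7/3 * ln 2" "ln (7::real) \<le> 3 * ln 2"
  "3/2 \<le> ln (5::real)" "19/12 * ln 2 \<le> ln (3::real)"
proof -
  have p: "ln ((a::real) ^ n) = real n * ln a" if "a > 0" for a n using that by (simp add: ln_realpow)
  have le: "ln a \<le> ln b" if "0 < a" "a \<le> b" for a b :: real using that by simp
  show "ln (3::real) \<le> 8/5 * ln 2" using le[of "3 ^ 5" "2 ^ 8"] by (simp only: p) simp
  show "ln (5::real) \<le> 7/3 * ln 2" using le[of "5 ^ 3" "2 ^ 7"] by (simp only: p) simp
  show "ln (7::real) \<le> 3 * ln 2" using le[of "7 ^ 1" "2 ^ 3"] by (simp only: p) simp
  show "3/2 \<le> ln (5::real)" using le[of "2 ^ 9" "5 ^ 4"] ln2_ge_two_thirds by (simp only: p) simp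
  show "19/12 * ln 2 \<le> ln (3::real)" using le[of "2 ^ 19" "3 ^ 12"] by (simp only: p) simp
qed

lemma ln_ge_one_minus_inverse: "x > 0 \<Longrightarrow> 1 - 1 / x \<le> ln (x::real)"
  using ln_le_minus_one[of "1 / x"] by (simp add: ln_div)

text \<open>The triple logarithm is negative for small \<open>q\<close>. The first two bounds serve
  the trivial estimate for Q < 256. The third ensures 29/5 \<le> 11/6 + 4, as needed for larger
  Q.\<close>

lemma iterated_log_bounds:
  fixes q :: real
  shows "5 \<le> q \<Longrightarrow> 0 \<le> ln q + ln (ln q) + ln (ln (ln q))"
    and "64 \<le> q \<Longrightarrow> 5 \<le> ln q + ln (ln q) + ln (ln (ln q))"
    and "256 \<le> q \<Longrightarrow> 11/6 \<le> ln (ln q) + ln (ln (ln q))"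
proof -
  note l2 = ln2_ge_two_thirds ln_small_bounds
  have mono: "ln a \<le> ln b" if "0 < a" "a \<le> b" for a b :: real using that by simp
  {
    assume "5 \<le> q"
    hence u: "ln q \<ge> 3/2" using mono[of 5 q] l2 by linarith
    have "ln (3/2::real) = ln 3 - ln 2" by (simp add: ln_div)
    hence "ln (3/2::real) \<ge> 7/18" using l2 by linarith
    hence v: "ln (ln q) \<ge> 7/18" using mono[OF _ u] by linarith
    have "ln (7/18::real) \<le> ln (ln (ln q))" using mono[OF _ v] by simp
    moreover have "- (11/7) \<le> ln (7/18::real)" using ln_ge_one_minus_inverse[of "7/18"] by simp
    ultimately show "0 \<le> ln q + ln (ln q) + ln (ln (ln q))" using u v by linarith
  }
  {
    assume "64 \<le> q"
    moreover have "ln (64::real) = 6 * ln 2" using ln_realpow[of 2 6] by simp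
    ultimately have u: "ln q \<ge> 4" using mono[of 64 q] l2 by linarith
    have "ln (4::real) = 2 * ln 2" using ln_realpow[of 2 2] by simp
    hence v: "ln (ln q) \<ge> 4/3" using mono[OF _ u] l2 by linarith
    have "ln (4/3::real) \<le> ln (ln (ln q))" using mono[OF _ v] by simp
    moreover have "1/4 \<le> ln (4/3::real)" using ln_ge_one_minus_inverse[of "4/3"] by simp
    ultimately show "5 \<le> ln q + ln (ln q) + ln (ln (ln q))" using u v by linarith
  }
  {
    assume "256 \<le> q"
    moreover have "ln (256::real) = 8 * ln 2" using ln_realpow[of 2 8] by simp
    ultimately have "ln q \<ge> 5" using mono[of 256 q] l2 by linarith
    hence v: "ln (ln q) \<ge> 3/2" using mono[of 5 "ln q"] l2 by linarith
    have "ln (3/2::real) \<le> ln (ln (ln q))" using mono[OF _ v] by simp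
    moreover have "1/3 \<le> ln (3/2::real)" using ln_ge_one_minus_inverse[of "3/2"] by simp
    ultimately show "11/6 \<le> ln (ln q) + ln (ln (ln q))" using v by linarith
  }
qed

text \<open>The slopes 1/4 and 1/10 are the values of 1 / (p - 1) at p = 5 and p = 11, the first
  primes outside the exceptional sets. They are small enough to keep the coefficient of log Q in
  \<open>sum_F_bound\<close> below 1.\<close>

lemma sum_log_prime_factors_le:
  assumes "d > 0"
  shows "(\<Sum>p\<in>prime_factors d. ln (real p) / (real p - 1)) \<le> 3/4 * ln 2 + 1/4 * ln 3 + 1/4 * ln (real d)"
    and "odd d \<Longrightarrow> (\<Sum>p\<in>prime_factors d. ln (real p) / (real p - 1))
            \<le> 2/5 * ln 3 + 3/20 * ln 5 + 1/15 * ln 7 + 1/10 * ln (real d)"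
proof -
  have "\<Prod>(prime_factors d) \<le> d" using prod_prime_factors_dvd[OF assms] assms by (rule dvd_imp_le)
  moreover have "\<Prod>(prime_factors d) > 0" by (rule prod_pos) (auto simp: prime_factors_gt_0_nat)
  ultimately have ln_le: "ln (real (\<Prod>(prime_factors d))) \<le> ln (real d)" by (intro ln_mono) (simp_all only: of_nat_le_iff of_nat_0_less_iff)
  have "(\<Sum>p\<in>prime_factors d. ln (real p) / (real p - 1)) \<le>
       (\<Sum>p\<in>{2,3}. (1 / (real p - 1) - 1/4) * ln (real p)) + 1/4 * ln (real (\<Prod>(prime_factors d)))"
  proof (rule sum_log_over_prime_le)
    fix p assume p: "p \<in> prime_factors d - {2,3}"
    hence "prime p" "p \<noteq> 2" "p \<noteq> 3" by auto
    moreover have "p \<noteq> 4" using \<open>prime p\<close> by auto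
    ultimately have "p \<ge> 5" using prime_ge_2_nat[of p] by linarith
    thus "1 / (real p - 1) \<le> 1/4" by (simp add: field_simps)
  qed auto
  thus "(\<Sum>p\<in>prime_factors d. ln (real p) / (real p - 1)) \<le> 3/4 * ln 2 + 1/4 * ln 3 + 1/4 * ln (real d)"
    using ln_le by simp
  assume odd: "odd d"
  have "(\<Sum>p\<in>prime_factors d. ln (real p) / (real p - 1)) \<le>
       (\<Sum>p\<in>{3,5,7}. (1 / (real p - 1) - 1/10) * ln (real p)) + 1/10 * ln (real (\<Prod>(prime_factors d)))"
  proof (rule sum_log_over_prime_le)
    fix p assume p: "p \<in> prime_factors d - {3,5,7}"
    have "p dvd d" using p by auto
    hence "odd p" using odd dvd_trans by blast
    hence pr: "prime p" "p \<noteq> 3" "p \<noteq> 5" "p \<noteq> 7" "odd p" using p by auto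
    have "p \<noteq> 9" using pr(1) using primes_dvd_imp_eq[of 3 p] pr(1,2) by auto
    moreover have "p \<noteq> 1" using pr(1) by auto
    moreover obtain j where "p = 2 * j + 1" using pr(5) by (auto elim: oddE)
    ultimately have "p \<ge> 11" using pr by presburger
    thus "1 / (real p - 1) \<le> 1/10" by (simp add: field_simps)
  qed auto
  thus "(\<Sum>p\<in>prime_factors d. ln (real p) / (real p - 1))
            \<le> 2/5 * ln 3 + 3/20 * ln 5 + 1/15 * ln 7 + 1/10 * ln (real d)"
    using ln_le by simp
qed

lemma totient_times_primes:
  assumes "finite P" "\<And>p. p \<in> P \<Longrightarrow> prime p \<and> \<not> p dvd d"
  shows "totient (d * \<Prod>P) = totient d * (\<Prod>p\<in>P. p - 1)"
  using assms
proof (induction P rule: finite_induct)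
  case (insert p P)
  have p: "prime p" "\<not> p dvd d" using insert.prems by auto
  have "\<not> p dvd \<Prod>P"
  proof
    assume "p dvd \<Prod>P"
    then obtain r where "r \<in> P" "p dvd r" using p insert.hyps by (auto simp: prime_dvd_prod_iff)
    thus False using p insert.prems insert.hyps by (metis insert_iff primes_dvd_imp_eq)
  qed
  hence "coprime p (d * \<Prod>P)" using p by (simp add: prime_imp_coprime prime_dvd_mult_iff)
  hence "totient (p * (d * \<Prod>P)) = totient p * totient (d * \<Prod>P)" by (rule totient_mult_coprime)
  moreover have "d * \<Prod>(insert p P) = p * (d * \<Prod>P)" using insert.hyps by simp
  ultimately show ?case using insert p by (simp add: totient_prime mult_ac)
qed simp

section \<open>The bound for a sieved primitive character\<close>

text \<open>The assumption \<open>prim\<close> is primitivity of \<open>f\<close> in Fourier form.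
  Together with d > 1 it makes the Gauss sum of the sieved character vanish at 0.\<close>

locale sieved_primitive =
  fixes d :: nat and f :: "int \<Rightarrow> complex" and P :: "nat set"
  assumes d: "d > 1" and char: "dirichlet_character d f"
    and prim: "\<And>k. \<not> coprime k (int d) \<Longrightarrow> gauss_sum f d k = 0"
    and finP: "finite P" and primeP: "\<And>p. p \<in> P \<Longrightarrow> prime p \<and> \<not> p dvd d"
begin

definition "Q = d * \<Prod>P"
definition "F = sieve_char P f"

lemma Q_pos: "Q > 0"
  using d primeP prime_gt_0_nat by (auto simp: Q_def intro!: prod_pos)

lemma char_F: "dirichlet_character Q F"
  unfolding Q_def F_def using char d finP primeP by (intro sieve_char) auto

lemma norm_gauss_sum_F:
  "cmod (gauss_sum F Q (int k)) = sqrt d * (if coprime k d then sieve_weight P k else 0)"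
  unfolding Q_def F_def using sieve_char(2)[OF char _ finP primeP] d
    norm_gauss_sum_primitive[OF char d prim] by simp

lemma gauss_sum_F_0: "gauss_sum F Q 0 = 0"
  using norm_gauss_sum_F[of 0] d by simp

lemma weight_nonneg: "sieve_weight P k \<ge> 0"
  using primeP by (intro sieve_weight_nonneg) auto

text \<open>Completion for \<open>F\<close> followed by folding. The moduli of its Gauss sums are
  sqrt d times the sieve weights, and their total over one period is known exactly.\<close>

lemma sum_F_le_sine_sum:
  "real Q * cmod (\<Sum>m\<in>{1..X::nat}. F (int m)) \<le> sqrt d * (2 * real Q / pi *
     (\<Sum>k\<in>cop_upto (prime_factors d) (real Q / 2). sieve_weight P k * \<bar>sin (real k * (pi * real X / real Q))\<bar> / real k)
     + real (totient d) * (\<Prod>p\<in>P. 2 * (real p - 1)) / 2)"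
proof -
  define W where "W = (\<lambda>k. cmod (gauss_sum F Q (int k)))"
  have W: "W k = sqrt d * (if coprime k d then sieve_weight P k else 0)" for k
    unfolding W_def by (rule norm_gauss_sum_F)
  have sym: "W (Q - k) = W k" if "0 < k" "k < Q" for k
  proof -
    \<comment> \<open>Since -1 is a unit, reversing the frequency does not change the
      modulus.\<close>
    have "gauss_sum F Q (int (Q - k)) = gauss_sum F Q ((- 1) * int k)"
      using gauss_sum_periodic[OF Q_pos, of F "- int k"] that by (simp add: of_nat_diff)
    thus ?thesis unfolding W_def using norm_gauss_sum_mult[OF char_F Q_pos, of "- 1" "int k"] by simp
  qed
  let ?R = "prime_factors d"
  have cop: "{k. 1 \<le> k \<and> real k \<le> Y \<and> coprime k d} = cop_upto ?R Y" for Y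
    using coprime_iff_prime_factors[of d] d by (auto simp: cop_upto_def)
  have fin: "finite {k::nat. 1 \<le> k \<and> real k \<le> Y}" for Y
    by (rule finite_subset[of _ "{1..nat \<lfloor>Y\<rfloor>}"]) (auto simp: le_nat_floor)
  define A where "A = (\<Sum>k\<in>cop_upto ?R (real Q / 2).
      sieve_weight P k * \<bar>sin (real k * (pi * real X / real Q))\<bar> / real k)"
  have "(\<Sum>k\<in>{1..<Q}. W k) \<le> (\<Sum>k\<in>{1..Q}. W k)"
    by (rule sum_mono2) (auto simp: W_def)
  also have "(\<Sum>k\<in>{1..Q}. W k) = (\<Sum>k\<in>cop_upto ?R (real Q). sqrt d * sieve_weight P k)"
    unfolding cop[symmetric] by (rule sum.mono_neutral_cong_right) (auto simp: W)
  also have "\<dots> = sqrt d * (real (totient d) * (\<Prod>p\<in>P. 2 * (real p - 1)))"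
    using sum_sieve_weight_coprime[of d P 1, OF _ finP primeP] d
    by (simp add: sum_distrib_left[symmetric] Q_def)
  finally have tot: "(\<Sum>k\<in>{1..<Q}. W k) / 2 \<le> sqrt d * (real (totient d) * (\<Prod>p\<in>P. 2 * (real p - 1))) / 2"
    by (rule divide_right_mono) simp
  have "real Q * cmod (\<Sum>m\<in>{1..X}. F (int m)) \<le>
      (\<Sum>k\<in>{1..<Q}. W k * (\<bar>sin (pi * real k * real X / real Q)\<bar> / sin (pi * real k / real Q)))"
    unfolding W_def
    by (rule completing_bound[OF Q_pos _ gauss_sum_F_0]) (rule dirichlet_characterD(1)[OF char_F])
  also have "\<dots> \<le> 2 * real Q / pi * (\<Sum>k\<in>{k. 1 \<le> k \<and> real k \<le> real Q / 2}. W k * \<bar>sin (real k * (pi * real X / real Q))\<bar> / real k)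
        + (\<Sum>k\<in>{1..<Q}. W k) / 2"
    by (rule sum_symmetric_kernel_le[of Q W, OF Q_pos _ sym]) (simp_all add: W_def)
  also have "(\<Sum>k\<in>{k. 1 \<le> k \<and> real k \<le> real Q / 2}. W k * \<bar>sin (real k * (pi * real X / real Q))\<bar> / real k) =
      sqrt d * A"
    unfolding A_def sum_distrib_left cop[symmetric] by (rule sum.mono_neutral_cong_right[OF fin]) (auto simp: W)
  finally have "real Q * cmod (\<Sum>m\<in>{1..X}. F (int m)) \<le>
      2 * real Q / pi * (sqrt d * A) + sqrt d * (real (totient d) * (\<Prod>p\<in>P. 2 * (real p - 1))) / 2"
    using tot by linarith
  thus ?thesis unfolding A_def[symmetric] distrib_left by (simp only: mult.left_commute[of "sqrt d"] times_divide_eq_right)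
qed

text \<open>\<open>C\<close> is the constant from the treatment of the sines and \<open>L\<close>
  the logarithmic factor. The normalisation rests on phi(Q) 2^|P| = phi(d) M and sqrt d / Q = 1 /
  (sqrt Q sqrt r), where M is the product of the 2 (p - 1) and r that of the p in
  \<open>P\<close>.\<close>

lemma sum_F_le:
  assumes "(\<Sum>k\<in>cop_upto (prime_factors d) (real Q / 2). sieve_weight P k * \<bar>sin (real k * (pi * real X / real Q))\<bar> / real k)
     \<le> C * (\<Prod>p\<in>P. 2 * (real p - 1) / real p) * (real (totient d) / real d * L)"
  shows "cmod (\<Sum>m\<in>{1..X::nat}. F (int m)) \<le>
     real (totient Q) / sqrt (real Q) * ((\<Prod>p\<in>P. 2 / sqrt (real p)) * (2 / pi * C * L + 1 / 2))"
proof -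
  define M where "M = (\<Prod>p\<in>P. 2 * (real p - 1))"
  define r where "r = real (\<Prod>P)"
  have r: "r > 0" using primeP prime_gt_0_nat unfolding r_def by (auto intro!: prod_pos)
  have d0: "real d > 0" using d by simp
  have Qr: "real Q = real d * r" by (simp add: Q_def r_def)
  have 1: "(\<Prod>p\<in>P. 2 * (real p - 1) / real p) = M / r"
    by (simp add: M_def r_def prod_dividef)
  have "real (\<Prod>p\<in>P. p - 1) = (\<Prod>p\<in>P. real p - 1)"
    unfolding of_nat_prod by (rule prod.cong) (use primeP prime_ge_1_nat in \<open>auto simp: of_nat_diff\<close>)
  note * = this
  have 2: "real (totient Q) * 2 ^ card P = real (totient d) * M"
  proof -
    have "M = 2 ^ card P * (\<Prod>p\<in>P. real p - 1)" by (simp only: M_def prod.distrib prod_constant)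
    thus ?thesis using * totient_times_primes[OF finP primeP] by (simp only: Q_def of_nat_mult mult_ac)
  qed
  have "sqrt r = (\<Prod>p\<in>P. sqrt (real p))"
    unfolding r_def of_nat_prod using finP by (induction P rule: finite_induct) (auto simp: real_sqrt_mult)
  hence 3: "(\<Prod>p\<in>P. 2 / sqrt (real p)) = 2 ^ card P / sqrt r"
    by (simp add: prod_dividef)
  have "real Q * cmod (\<Sum>m\<in>{1..X}. F (int m)) \<le> sqrt d * (2 * real Q / pi *
     (C * (M / r) * (real (totient d) / real d * L)) + real (totient d) * M / 2)"
    by (rule order.trans[OF sum_F_le_sine_sum], unfold M_def[symmetric])
       (intro mult_left_mono add_right_mono assms[unfolded 1], simp_all)
  also have "\<dots> = sqrt d * (real (totient d) * M) * (2 / pi * C * L + 1 / 2)"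
    using r d0 by (simp add: Qr field_simps)
  also have "\<dots> = sqrt d * real (totient Q) * 2 ^ card P * (2 / pi * C * L + 1 / 2)"
    unfolding 2[symmetric] by (simp only: mult.assoc)
  finally have "cmod (\<Sum>m\<in>{1..X}. F (int m)) \<le>
      sqrt d * real (totient Q) * 2 ^ card P * (2 / pi * C * L + 1 / 2) / real Q"
    using Q_pos by (simp add: pos_le_divide_eq mult.commute)
  also have "sqrt d * real (totient Q) * 2 ^ card P / real Q =
      real (totient Q) / sqrt (real Q) * (2 ^ card P / sqrt r)"
  proof -
    have "sqrt d / real Q = 1 / (sqrt (real Q) * sqrt r)"
      using d0 r by (simp add: Qr real_sqrt_mult field_simps)
    moreover have "sqrt d * real (totient Q) * 2 ^ card P / real Q = real (totient Q) * 2 ^ card P * (sqrt d / real Q)"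
      by simp
    ultimately show ?thesis by (simp only:) simp
  qed
  hence "sqrt d * real (totient Q) * 2 ^ card P * (2 / pi * C * L + 1 / 2) / real Q =
      real (totient Q) / sqrt (real Q) * (2 ^ card P / sqrt r) * (2 / pi * C * L + 1 / 2)"
    by (metis times_divide_eq_left)
  finally show ?thesis unfolding 3 by (simp only: mult.assoc)
qed

text \<open>If 2 lies in \<open>P\<close>, the harmonic sum is taken over odd frequencies only: the
  density halves, \<open>L\<close> gains ln 2, and C = sqrt 3 / 2. Otherwise the sines are bounded
  by 1 and C = 1.\<close>

lemma sum_F_bound:
  "cmod (\<Sum>m\<in>{1..X::nat}. F (int m)) \<le> real (totient Q) / sqrt (real Q) * (ln (real Q) + 29/5)"
proof -
  let ?R = "prime_factors d" and ?K = "\<Prod>p\<in>P. 2 / sqrt (real p)" and ?\<theta> = "pi * real X / real Q"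
  let ?E = "\<Sum>p\<in>?R. ln (real p) / (real p - 1)" and ?w = "sieve_weight P"
  let ?\<Pi> = "\<Prod>p\<in>P. 2 * (real p - 1) / real p"
  define Y where "Y = real Q / 2"
  have Q: "real Q \<ge> 1" and Y: "Y > 0" using Q_pos by (simp_all add: Y_def)
  have Rprime: "prime p" if "p \<in> ?R" for p using that by auto
  have dQ: "d \<le> Q" using Q_pos unfolding Q_def by (intro dvd_imp_le) auto
  have d0: "d > 0" using d by simp
  have l: "ln (real d) \<le> ln (real Q)" "ln (real Q) \<ge> 0" using dQ d Q by auto
  have lnY: "ln Y = ln (real Q) - ln 2" using Q_pos by (simp add: Y_def ln_div)
  have A: "(\<Prod>p\<in>?R. 1 - 1 / real p) = real (totient d) / real d"
    using totient_formula2[of d] d by simp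
  have Pi0: "?\<Pi> \<ge> 0" using primeP prime_ge_1_nat by (force intro!: prod_nonneg)
  have K0: "?K \<ge> 0" by (intro prod_nonneg) auto
  have P': "\<And>p. p \<in> P \<Longrightarrow> prime p" using primeP by blast
  have numeric: "?K * (c * L + 1 / 2) \<le> K' * (c' * L' + 1 / 2)"
    if "?K \<le> K'" "0 \<le> c" "c \<le> c'" "L \<le> L'" "0 \<le> L'" for K' c c' L L' :: real
  proof -
    have "c * L \<le> c * L'" using that by (intro mult_left_mono)
    also have "\<dots> \<le> c' * L'" using that by (intro mult_right_mono)
    finally have "?K * (c * L + 1 / 2) \<le> ?K * (c' * L' + 1 / 2)" using K0 by (intro mult_left_mono) auto
    also have "\<dots> \<le> K' * (c' * L' + 1 / 2)" using that by (intro mult_right_mono) auto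
    finally show ?thesis .
  qed
  note small = ln_small_bounds ln2_le_25_over_36 euler_mascheroni_less_13_over_22
  have pi: "pi > 3.1415" using pi_approx by simp
  have "\<exists>C L. (\<Sum>k\<in>cop_upto ?R Y. ?w k * \<bar>sin (real k * ?\<theta>)\<bar> / real k)
           \<le> C * ?\<Pi> * (real (totient d) / real d * L) \<and>
        ?K * (2 / pi * C * L + 1 / 2) \<le> ln (real Q) + 29/5"
  proof (cases "2 \<in> P")
    case True
    have odd: "odd d" and twoR: "2 \<notin> ?R" using primeP[OF True] by (auto simp: prime_factors_dvd)
    have r: "real (\<Prod>P) \<ge> 2"
    proof -
      have "2 dvd \<Prod>P" using True finP by (intro dvd_prodI)
      moreover have "\<Prod>P > 0" using P' prime_gt_0_nat by (auto intro!: prod_pos)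
      ultimately have "2 \<le> \<Prod>P" by (intro dvd_imp_le)
      thus ?thesis by (metis of_nat_le_iff of_nat_numeral)
    qed
    have A2: "(\<Prod>p\<in>insert 2 ?R. 1 - 1 / real p) = real (totient d) / real d / 2"
      using twoR A by simp
    have E2: "(\<Sum>p\<in>insert 2 ?R. ln (real p) / (real p - 1)) = ln 2 + ?E"
      using twoR by simp
    define L where "L = ln Y + euler_mascheroni + (ln 2 + ?E) + 4"
    \<comment> \<open>The additional prime 2 doubles the error term; the factor 2 in the product of
      \<open>P\<close> pays for it.\<close>
    have "2 ^ card ?R * 2 \<le> real (totient d) * real (\<Prod>P)"
    proof -
      have "2 ^ card ?R \<le> real (totient d)"
        using two_power_omega_le_totient(2)[OF d0 odd] by (metis of_nat_le_iff of_nat_numeral of_nat_power)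
      thus ?thesis using r by (intro mult_mono) auto
    qed
    hence card: "2 ^ card (insert 2 ?R) \<le> 4 * Y * (\<Prod>p\<in>insert 2 ?R. 1 - 1 / real p)"
      unfolding A2 Y_def Q_def using twoR d0 by (simp add: mult.commute)
    have pr: "prime r" if "r \<in> insert 2 ?R" for r using that by auto
    have "cop_harm (insert 2 ?R) Y \<le> real (totient d) / real d / 2 * L"
      using cop_harm_le[OF _ pr Y card] unfolding A2 E2 L_def by simp
    moreover have "(\<Sum>k\<in>cop_upto ?R Y. ?w k * \<bar>sin (real k * ?\<theta>)\<bar> / real k) \<le>
        sqrt 3 * (\<Sum>k\<in>cop_upto (insert 2 ?R) Y. ?w k / real k)"
    proof (rule sum_abs_sin_le[OF Rprime twoR weight_nonneg])
      show "?w (2 * k) = ?w k" for k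
        unfolding sieve_weight_def
        by (rule prod.cong) (use P' prime_dvd_mult_prime_iff[of 2] in auto)
    qed
    moreover have "(\<Sum>k\<in>cop_upto (insert 2 ?R) Y. ?w k / real k) \<le> ?\<Pi> * cop_harm (insert 2 ?R) Y"
      by (rule sum_sieve_weight_le[OF finP P' pr])
    ultimately have U: "(\<Sum>k\<in>cop_upto ?R Y. ?w k * \<bar>sin (real k * ?\<theta>)\<bar> / real k) \<le>
        sqrt 3 * (?\<Pi> * (real (totient d) / real d / 2 * L))"
      using Pi0 by (meson mult_left_mono order.trans real_sqrt_ge_zero zero_le_numeral)
    have 1: "(\<Sum>k\<in>cop_upto ?R Y. ?w k * \<bar>sin (real k * ?\<theta>)\<bar> / real k) \<le>
        sqrt 3 / 2 * ?\<Pi> * (real (totient d) / real d * L)"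
    proof -
      have "a * (b * (t / 2 * l)) = a / 2 * b * (t * l)" for a b t l :: real by simp
      thus ?thesis using U by (simp only:)
    qed
    have "L \<le> 1.1 * ln (real Q) + 5.42"
      unfolding L_def lnY using sum_log_prime_factors_le(2)[OF d0 odd] l small by simp
    moreover have "sqrt 3 \<le> (1.7321::real)" by (rule real_le_lsqrt) (simp_all add: power2_eq_square)
    hence "2 / pi * (sqrt 3 / 2) \<le> 0.5514" using pi by (simp add: field_simps)
    \<comment> \<open>This is the tight case: multiplied out, the coefficient of the logarithm is
      about 0.991 and the constant about 5.70.\<close>
    ultimately have "?K * (2 / pi * (sqrt 3 / 2) * L + 1 / 2) \<le> 1.634 * (0.5514 * (1.1 * ln (real Q) + 5.42) + 1 / 2)"
      by (intro numeric prod_two_over_sqrt_le finP P') (use l in auto)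
    also have "\<dots> \<le> ln (real Q) + 29/5" using l(2) by (simp add: field_simps)
    finally show ?thesis using 1 by blast
  next
    case False
    define L where "L = ln Y + euler_mascheroni + ?E + 4"
    have "2 ^ card ?R \<le> 2 * real (totient d) * real (\<Prod>P)"
    proof -
      have "2 ^ card ?R \<le> 2 * real (totient d)"
        using two_power_omega_le_totient(1)[OF d0] by (metis of_nat_le_iff of_nat_mult of_nat_numeral of_nat_power)
      moreover have "\<Prod>P > 0" using P' prime_gt_0_nat by (auto intro!: prod_pos)
      hence "1 \<le> real (\<Prod>P)" by (metis One_nat_def Suc_leI of_nat_1 of_nat_le_iff)
      ultimately show ?thesis using mult_mono[of "2 ^ card ?R" "2 * real (totient d)" 1 "real (\<Prod>P)"] by simp
    qed
    hence card: "2 ^ card ?R \<le> 4 * Y * (\<Prod>p\<in>?R. 1 - 1 / real p)"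
      unfolding A Y_def Q_def using d0 by (simp add: mult_ac)
    have "cop_harm ?R Y \<le> real (totient d) / real d * L"
      using cop_harm_le[OF _ Rprime Y card] unfolding A L_def by simp
    moreover have "(\<Sum>k\<in>cop_upto ?R Y. ?w k * \<bar>sin (real k * ?\<theta>)\<bar> / real k) \<le>
        (\<Sum>k\<in>cop_upto ?R Y. ?w k / real k)"
      by (intro sum_mono divide_right_mono mult_left_le abs_sin_le_one weight_nonneg) auto
    moreover have "(\<Sum>k\<in>cop_upto ?R Y. ?w k / real k) \<le> ?\<Pi> * cop_harm ?R Y"
      by (rule sum_sieve_weight_le[OF finP P' Rprime])
    ultimately have 1: "(\<Sum>k\<in>cop_upto ?R Y. ?w k * \<bar>sin (real k * ?\<theta>)\<bar> / real k) \<le>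
        1 * ?\<Pi> * (real (totient d) / real d * L)"
      using Pi0 by (metis (no_types, lifting) mult_1 mult_left_mono order.trans)
    have "L \<le> 1.25 * ln (real Q) + 4.7"
      unfolding L_def lnY using sum_log_prime_factors_le(1)[OF d0] l small by simp
    moreover have "2 / pi * 1 \<le> 0.6367" using pi by (simp add: field_simps)
    \<comment> \<open>Here the coefficient of the logarithm is below 0.92 and the constant below
      4.04.\<close>
    ultimately have "?K * (2 / pi * 1 * L + 1 / 2) \<le> 1.1548 * (0.6367 * (1.25 * ln (real Q) + 4.7) + 1 / 2)"
      by (intro numeric prod_two_over_sqrt_le finP P' False) (use l in auto)
    also have "\<dots> \<le> ln (real Q) + 29/5" using l(2) by (simp add: field_simps)
    finally show ?thesis using 1 by blast
  qed
  then obtain C L where CL: "(\<Sum>k\<in>cop_upto ?R Y. ?w k * \<bar>sin (real k * ?\<theta>)\<bar> / real k)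
           \<le> C * ?\<Pi> * (real (totient d) / real d * L)"
        "?K * (2 / pi * C * L + 1 / 2) \<le> ln (real Q) + 29/5" by blast
  have "cmod (\<Sum>m\<in>{1..X}. F (int m)) \<le> real (totient Q) / sqrt (real Q) * (?K * (2 / pi * C * L + 1 / 2))"
    by (rule sum_F_le) (use CL(1) in \<open>simp only: Y_def\<close>)
  also have "\<dots> \<le> real (totient Q) / sqrt (real Q) * (ln (real Q) + 29/5)"
    by (intro mult_left_mono CL(2)) simp
  finally show ?thesis .
qed

end

section \<open>The trivial bound, comparison of moduli and conclusion\<close>

lemma norm_sum_le_half_totient:
  assumes F: "dirichlet_character q F" "q > 1" and sum0: "gauss_sum F q 0 = 0"
  shows "cmod (\<Sum>m\<in>{1..X::nat}. F (int m)) \<le> real (totient q) / 2"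
proof -
  have q: "q > 0" using F by simp
  define S where "S = (\<lambda>X. \<Sum>m\<in>{1..X::nat}. F (int m))"
  \<comment> \<open>The Gauss sum at 0 is the sum over a period. Its vanishing allows
    \<open>X\<close> to be reduced modulo \<open>q\<close>.\<close>
  have period: "(\<Sum>m\<in>{X+1..X+q}. F (int m)) = 0" for X
  proof -
    have "(\<Sum>m\<in>{X+1..X+q}. F (int m)) = (\<Sum>a\<in>{0..<int q}. F (a + (int X + 1)))"
      by (rule sum.reindex_bij_witness[of _ "\<lambda>a. nat a + X + 1" "\<lambda>m. int m - int X - 1"]) auto
    also have "\<dots> = (\<Sum>a\<in>{0..<int q}. F a)"
      by (rule sum_periodic_shift[OF q]) (rule dirichlet_characterD(1)[OF F(1)])
    also have "\<dots> = gauss_sum F q 0" by (simp add: gauss_sum_def)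
    finally show ?thesis using sum0 by simp
  qed
  have split: "S (X + Y) = S X + (\<Sum>m\<in>{X+1..X+Y}. F (int m))" for X Y
    unfolding S_def using sum.ub_add_nat[of 1 X "\<lambda>m. F (int m)" Y] by simp
  have shift: "S (X + n * q) = S X" for X n
  proof (induction n)
    case (Suc n)
    have "S (X + Suc n * q) = S (X + n * q + q)" by (simp add: algebra_simps)
    also have "\<dots> = S X" using Suc split[of "X + n * q" q] period[of "X + n * q"] by simp
    finally show ?case .
  qed simp
  define s where "s = X mod q"
  have s: "s \<le> q" using q by (simp add: s_def less_imp_le)
  have SX: "S X = S s" using shift[of s "X div q"] by (simp add: s_def)
  let ?c = "\<lambda>m. if coprime m q then 1 else (0::real)"
  have nF: "cmod (F (int m)) = ?c m" for m
    using dirichlet_character_norm[OF F(1) q, of "int m"] by simp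
  \<comment> \<open>The sums over the initial segment and over the rest of the period are opposite.
    The two pieces share phi(q) units, so one of them contains at most half.\<close>
  have "S s + (\<Sum>m\<in>{s+1..q}. F (int m)) = 0"
    using split[of s "q - s"] s period[of 0] by (simp add: S_def)
  hence "cmod (S s) = cmod (\<Sum>m\<in>{s+1..q}. F (int m))"
    by (metis add_eq_0_iff norm_minus_cancel)
  also have "\<dots> \<le> (\<Sum>m\<in>{s+1..q}. ?c m)" by (rule sum_norm_le) (simp add: nF)
  finally have 1: "cmod (S s) \<le> (\<Sum>m\<in>{s+1..q}. ?c m)" .
  have 2: "cmod (S s) \<le> (\<Sum>m\<in>{1..s}. ?c m)" unfolding S_def by (rule sum_norm_le) (simp add: nF)
  have "(\<Sum>m\<in>{1..s}. ?c m) + (\<Sum>m\<in>{s+1..q}. ?c m) = (\<Sum>m\<in>{1..q}. ?c m)"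
    using sum.ub_add_nat[of 1 s ?c "q - s"] s by simp
  also have "\<dots> = (\<Sum>m\<in>{m\<in>{1..q}. coprime m q}. 1)"
    by (rule sum.inter_filter[symmetric]) simp
  also have "\<dots> = real (totient q)" using card_coprime_interval[of q] by simp
  finally show ?thesis using 1 2 SX by (simp add: S_def)
qed

text \<open>With equal prime divisors both quotients are the square root of the modulus times the
  same product of the 1 - 1 / p.\<close>

lemma totient_over_sqrt_mono:
  assumes "m dvd n" "n > 0" "prime_factors m = prime_factors n"
  shows "real (totient m) / sqrt (real m) \<le> real (totient n) / sqrt (real n)"
proof -
  define A where "A = (\<Prod>p\<in>prime_factors n. 1 - 1 / real p)"
  have A: "real (totient k) / sqrt (real k) = sqrt (real k) * A" if "prime_factors k = prime_factors n" for k
  proof -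
    have "real (totient k) / sqrt (real k) = real k / sqrt (real k) * A"
      using totient_formula2[of k] that by (simp add: A_def)
    thus ?thesis by (simp add: real_div_sqrt)
  qed
  have "A \<ge> 0" unfolding A_def
  proof (rule prod_nonneg)
    fix p assume "p \<in> prime_factors n"
    hence "real p \<ge> 1" using prime_ge_1_nat[of p] by auto
    thus "0 \<le> 1 - 1 / real p" by simp
  qed
  moreover have "m \<le> n" using assms by (intro dvd_imp_le)
  ultimately show ?thesis unfolding A[OF assms(3)] A[OF refl] by (intro mult_right_mono) auto
qed

theorem theorem1p2:
  fixes q :: nat and \<chi> :: "int \<Rightarrow> complex" and x :: real
  assumes "q \<ge> 5"
    and "dirichlet_character q \<chi>"
    and "\<chi> \<noteq> principal_character q"
  shows "cmod (\<Sum>m\<in>{m :: int. 1 \<le> m \<and> real_of_int m \<le> x}. \<chi> m)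
           \<le> real (totient q) / sqrt (real q)
               * (ln (real q) + ln (ln (real q)) + ln (ln (ln (real q))) + 4)"
proof -
  have q: "q > 0" using assms(1) by simp
  obtain d f where dq: "d > 0" "d dvd q" and f: "dirichlet_character d f"
    and \<chi>f: "\<And>a. coprime a (int q) \<Longrightarrow> \<chi> a = f a"
    and prim: "\<And>k. \<not> coprime k (int d) \<Longrightarrow> gauss_sum f d k = 0"
    using exists_primitive_character[OF assms(2) q] by blast
  have \<chi>0: "\<chi> a = 0" if "\<not> coprime a (int q)" for a
    using that dirichlet_characterD(3)[OF assms(2)] by blast
  have "d \<noteq> 1"
  proof
    assume "d = 1"
    hence "f a = 1" for a
      using dirichlet_character_cong[OF f, of a 1] dirichlet_character_1[OF f] by simp
    hence "\<chi> = principal_character q"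
      using \<chi>f \<chi>0 by (auto simp: fun_eq_iff principal_character_def)
    thus False using assms(3) by contradiction
  qed
  hence d1: "d > 1" using dq by simp
  \<comment> \<open>Where \<chi> vanishes depends only on the primes of \<open>q\<close>, so sieving
    \<open>f\<close> by these primes recovers \<chi> exactly, already as a character modulo
    \<open>Q\<close>.\<close>
  define P where "P = {p\<in>prime_factors q. \<not> p dvd d}"
  interpret sieved_primitive d f P
    by unfold_locales (use d1 f prim in \<open>auto simp: P_def\<close>)
  have \<chi>F: "\<chi> a = F a" for a
  proof (cases "coprime a (int q)")
    case True
    have "\<not> int p dvd a" if "p \<in> P" for p
    proof
      assume "int p dvd a"
      moreover have "int p dvd int q" "prime (int p)" using that by (auto simp: P_def)
      ultimately show False using True by (meson coprime_common_divisor not_prime_unit)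
    qed
    thus ?thesis using \<chi>f[OF True] by (auto simp: F_def sieve_char_def)
  next
    case False
    have "F a = 0"
    proof (cases "\<exists>p\<in>P. int p dvd a")
      case no: False
      have "\<not> coprime a (int d)"
      proof
        assume cop: "coprime a (int d)"
        have "gcd a (int q) \<noteq> 1" using False by (simp add: coprime_iff_gcd_eq_1)
        hence "nat (gcd a (int q)) \<noteq> 1" by simp
        then obtain p where p: "prime p" "p dvd nat (gcd a (int q))" using prime_factor_nat by blast
        hence "int p dvd gcd a (int q)" by (metis gcd_ge_0_int int_dvd_int_iff nat_0_le)
        hence pa: "int p dvd a" "p dvd q" by auto
        hence "p dvd d" using no p q by (auto simp: P_def prime_factors_dvd)
        hence "int p dvd int d" "prime (int p)" using p by auto
        thus False using cop pa(1) by (meson coprime_common_divisor not_prime_unit)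
      qed
      hence "f a = 0" using dirichlet_characterD(3)[OF f] by blast
      thus ?thesis by (simp add: F_def sieve_char_def)
    qed (simp add: F_def sieve_char_def)
    thus ?thesis using \<chi>0[OF False] by simp
  qed
  \<comment> \<open>For x < 1 this is 0, and both sums are empty.\<close>
  define X where "X = nat \<lfloor>x\<rfloor>"
  have "{m :: int. 1 \<le> m \<and> real_of_int m \<le> x} = int ` {1..X}"
  proof (intro equalityI subsetI)
    fix m assume "m \<in> {m :: int. 1 \<le> m \<and> real_of_int m \<le> x}"
    hence "m = int (nat m)" "nat m \<in> {1..X}" by (auto simp: X_def le_floor_iff nat_le_iff)
    thus "m \<in> int ` {1..X}" by blast
  next
    fix m assume "m \<in> int ` {1..X}"
    then obtain n where n: "m = int n" "1 \<le> n" "n \<le> nat \<lfloor>x\<rfloor>" by (auto simp: X_def)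
    hence "int n \<le> \<lfloor>x\<rfloor>" by linarith
    hence "real_of_int (int n) \<le> x" by (simp only: le_floor_iff)
    thus "m \<in> {m :: int. 1 \<le> m \<and> real_of_int m \<le> x}" using n by simp
  qed
  hence S: "(\<Sum>m\<in>{m :: int. 1 \<le> m \<and> real_of_int m \<le> x}. \<chi> m) = (\<Sum>m\<in>{1..X}. F (int m))"
    by (simp add: sum.reindex \<chi>F)
  have prod_dvd: "\<Prod>P dvd q"
    using prod_dvd_prod_subset[of "prime_factors q" P "\<lambda>p. p"] prod_prime_factors_dvd[OF q]
    by (auto simp: P_def intro: dvd_trans)
  have "coprime d (\<Prod>P)"
    using primeP by (intro prod_coprime_right) (metis coprime_commute prime_imp_coprime)
  hence Qq: "Q dvd q" unfolding Q_def using dq(2) prod_dvd by (intro divides_mult)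
  have "prime_factors Q = prime_factors q"
  proof
    show "prime_factors Q \<subseteq> prime_factors q" using Qq q by (intro dvd_prime_factors) auto
    show "prime_factors q \<subseteq> prime_factors Q"
    proof
      fix p assume p: "p \<in> prime_factors q"
      have "p dvd Q"
      proof (cases "p dvd d")
        case False
        hence "p dvd \<Prod>P" using p finP by (intro dvd_prodI) (auto simp: P_def)
        thus ?thesis by (simp add: Q_def)
      qed (simp add: Q_def)
      thus "p \<in> prime_factors Q" using p Q_pos by (auto simp: prime_factors_dvd)
    qed
  qed
  hence mono: "real (totient Q) / sqrt (real Q) \<le> real (totient q) / sqrt (real q)"
    using Qq q by (intro totient_over_sqrt_mono)
  have Qle: "Q \<le> q" using Qq q by (rule dvd_imp_le)
  have "d \<le> Q" using Q_pos by (intro dvd_imp_le) (simp_all add: Q_def)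
  hence Q1: "Q > 1" using d1 by simp
  let ?T = "ln (real q) + ln (ln (real q)) + ln (ln (ln (real q))) + 4"
  \<comment> \<open>Nonnegativity of \<open>B\<close> is recorded for the final passage from
    \<open>Q\<close> to \<open>q\<close>, where \<open>mono\<close> is multiplied by B \<le>
    \<open>?T\<close>.\<close>
  have "\<exists>B. cmod (\<Sum>m\<in>{1..X}. F (int m)) \<le> real (totient Q) / sqrt (real Q) * B \<and> B \<le> ?T \<and> 0 \<le> B"
  proof (cases "Q < 256")
    case True
    have "real (totient Q) / 2 = real (totient Q) / sqrt (real Q) * (sqrt (real Q) / 2)"
      using Q_pos by simp
    hence 1: "cmod (\<Sum>m\<in>{1..X}. F (int m)) \<le> real (totient Q) / sqrt (real Q) * (sqrt (real Q) / 2)"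
      using norm_sum_le_half_totient[OF char_F Q1 gauss_sum_F_0, of X] by simp
    have "sqrt (real Q) / 2 \<le> ?T"
    \<comment> \<open>For q < 64 the left-hand side is at most 4, the constant term alone. From 64
      on it is at most 8, and the right-hand side is at least 9.\<close>
    proof (cases "q < 64")
      case True
      hence "sqrt (real Q) \<le> sqrt 64" using Qle by (intro real_sqrt_le_mono) simp
      thus ?thesis using iterated_log_bounds(1)[of "real q"] assms(1) by simp
    next
      case False
      have "sqrt (real Q) \<le> sqrt 256" using \<open>Q < 256\<close> by (intro real_sqrt_le_mono) simp
      thus ?thesis using iterated_log_bounds(2)[of "real q"] False by simp
    qed
    thus ?thesis using 1 by (intro exI[of _ "sqrt (real Q) / 2"]) simp
  next
    case False
    have "ln (real Q) \<le> ln (real q)" using Qle Q_pos by simp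
    moreover have "ln (real Q) \<ge> 0" using Q_pos by simp
    moreover have "11/6 \<le> ln (ln (real q)) + ln (ln (ln (real q)))"
      using False Qle by (intro iterated_log_bounds(3)) simp
    ultimately show ?thesis using sum_F_bound[of X] by (intro exI[of _ "ln (real Q) + 29/5"]) simp
  qed
  then obtain B where B: "cmod (\<Sum>m\<in>{1..X}. F (int m)) \<le> real (totient Q) / sqrt (real Q) * B" "B \<le> ?T" "0 \<le> B"
    by blast
  have "real (totient Q) / sqrt (real Q) * B \<le> real (totient q) / sqrt (real q) * ?T"
    using mono B by (intro mult_mono) auto
  thus ?thesis unfolding S using B(1) by linarith
qed

end
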